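(* Let $\beta=2$ and define $H_n$ by $H_n(-z)=z\,\xi_n^{(2)\prime}(z)$ for $z<0$. Then $H_n(z)$ satisfies the nonlinear second order ODE (for $z>0$) $$(zH_n'')^2=4H_n\bigl((H_n')^2-H_n'\bigr)-\Bigl(4z(H_n')^2-\bigl(4z+(b-2n)^2\bigr)H_n'-2n(b-2n)\Bigr)H_n'+n^2 .$$
   Context: Let $n\ge1$ be an integer and $b=\frac{3\beta n}2+2-\beta$, i.e. $b=3n$ for $\beta=2$. For $z<0$ let $$M_n^{(2)}(z)=\frac1{m_n^{(2)}}\int_{\mathbb R_+^n}\prod_{j=1}^n\lambda_j^{-b}\exp\left(-\frac1{\lambda_j}+z\lambda_j\right)\prod_{1\le j<k\le n}|\lambda_k-\lambda_j|^2\,d\lambda_1\cdots d\lambda_n,$$ where $m_n^{(2)}$ is the constant such that $M_n^{(2)}(0)=1$, and $\xi_n^{(2)}(z)=\log M_n^{(2)}(z)$. Primes denote differentiation of a function with respect to its argument. *)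

theory Defs
  imports "HOL-Analysis.Analysis"
begin

definition b_exp :: "real \<Rightarrow> nat \<Rightarrow> real" where
  "b_exp \<beta> n = 3 * \<beta> * real n / 2 + 2 - \<beta>"

definition Rplus :: "nat \<Rightarrow> (nat \<Rightarrow> real) set" where
  "Rplus n = (\<Pi>\<^sub>E j\<in>{1..n}. {0<..})"

definition weight2 :: "nat \<Rightarrow> real \<Rightarrow> (nat \<Rightarrow> real) \<Rightarrow> real" where
  "weight2 n z x =
     (\<Prod>j\<in>{1..n}. x j powr (- b_exp 2 n) * exp (- 1 / x j + z * x j)) *
     (\<Prod>(j, k)\<in>{(j, k). 1 \<le> j \<and> j < k \<and> k \<le> n}. \<bar>x k - x j\<bar> ^ 2)"

(* The space R^n, with n varying in the statement, is rendered by the functions on {1..n},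
   with the n-fold product of Lebesgue measure. *)
definition I2 :: "nat \<Rightarrow> real \<Rightarrow> real" where
  "I2 n z = (LINT x:Rplus n|PiM {1..n} (\<lambda>_. lborel). weight2 n z x)"

(* The normalisation M2 n 0 = 1 forces the constant m_n to be the integral at z = 0. *)
definition m2 :: "nat \<Rightarrow> real" where
  "m2 n = I2 n 0"

definition M2 :: "nat \<Rightarrow> real \<Rightarrow> real" where
  "M2 n z = 1 / m2 n * I2 n z"

definition xi2 :: "nat \<Rightarrow> real \<Rightarrow> real" where
  "xi2 n z = ln (M2 n z)"

end

theory Submission
  imports Defs "HOL-Probability.Sinc_Integral" "HOL-Real_Asymp.Real_Asymp"
    "Jordan_Normal_Form.Determinant"
begin

text \<open>
  For \<open>x = -z > 0\<close> let \<open>P\<^sub>n\<close> be the monic orthogonal polynomials of the weight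
  \<open>t\<^bsup>-b\<^esup> exp (-1/t - x t)\<close>, \<open>h\<^sub>n\<close> their squared norms, and
  \<open>t P\<^sub>n = P\<^sub>n\<^sub>+\<^sub>1 + a\<^sub>n P\<^sub>n + \<beta>\<^sub>n P\<^sub>n\<^sub>-\<^sub>1\<close>. Expanding the Vandermonde determinant in the \<open>P\<^sub>k\<close> turns the
  \<open>n\<close>-fold integral into \<open>n! h\<^sub>0 \<dots> h\<^sub>n\<^sub>-\<^sub>1\<close>. The Toda flow in \<open>x\<close> gives \<open>h\<^sub>k' = -a\<^sub>k h\<^sub>k\<close>, so that
  \<open>H = x s\<close> with \<open>s = -(a\<^sub>0 + \<dots> + a\<^sub>n\<^sub>-\<^sub>1)\<close>, \<open>s' = \<beta>\<^sub>n\<close> and \<open>\<beta>\<^sub>n' = \<beta>\<^sub>n (a\<^sub>n\<^sub>-\<^sub>1 - a\<^sub>n)\<close>.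

  Integration by parts gives \<open>t\<^sup>2 dP\<^sub>n/dt = (n t - H') P\<^sub>n + \<beta>\<^sub>n (x t + e\<^sub>n) P\<^sub>n\<^sub>-\<^sub>1\<close> with
  \<open>e\<^sub>n = b - 2n - 1 + x a\<^sub>n\<close>. Expanding this linear system at its singular point \<open>t = 0\<close> yields
  \<open>H' (H' - 1) = \<beta>\<^sub>n e\<^sub>n e\<^sub>n\<^sub>-\<^sub>1\<close> and \<open>x \<beta>\<^sub>n (e\<^sub>n + e\<^sub>n\<^sub>-\<^sub>1) = (b - 2n) H' + n\<close>. Since
  \<open>H'' = -\<beta>\<^sub>n (e\<^sub>n - e\<^sub>n\<^sub>-\<^sub>1)\<close> and \<open>x\<^sup>2 \<beta>\<^sub>n = x H' - H\<close>, the differential equation is the identity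
  \<open>(e\<^sub>n - e\<^sub>n\<^sub>-\<^sub>1)\<^sup>2 = (e\<^sub>n + e\<^sub>n\<^sub>-\<^sub>1)\<^sup>2 - 4 e\<^sub>n e\<^sub>n\<^sub>-\<^sub>1\<close>.
\<close>

hide_const (open) module.smult

section \<open>Orthogonal polynomials of a positive functional\<close>

text \<open>The monic orthogonal polynomials are built by the Stieltjes recurrence rather than by
  Gram-Schmidt, so degree and leading coefficient are known for every \<open>L\<close>;
  orthogonality is proved below for positive functionals.\<close>

fun orth_poly :: "(real poly \<Rightarrow> real) \<Rightarrow> nat \<Rightarrow> real poly" where
  "orth_poly L 0 = 1"
| "orth_poly L (Suc 0) = pCons 0 1 - smult (L (pCons 0 1) / L 1) 1"
| "orth_poly L (Suc (Suc n)) =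
     (let p = orth_poly L (Suc n); q = orth_poly L n
      in pCons 0 p - smult (L (pCons 0 (p * p)) / L (p * p)) p - smult (L (p * p) / L (q * q)) q)"

definition orth_norm :: "(real poly \<Rightarrow> real) \<Rightarrow> nat \<Rightarrow> real" where
  "orth_norm L n = L (orth_poly L n * orth_poly L n)"

definition rec_a :: "(real poly \<Rightarrow> real) \<Rightarrow> nat \<Rightarrow> real" where
  "rec_a L n = L (pCons 0 (orth_poly L n * orth_poly L n)) / orth_norm L n"

text \<open>The value 0 at \<open>n = 0\<close> makes the three-term recurrence uniform: it cancels
  the term with index \<open>n - 1\<close>, where truncated subtraction gives
  \<open>orth_poly L 0\<close> again.\<close>

definition rec_b :: "(real poly \<Rightarrow> real) \<Rightarrow> nat \<Rightarrow> real" where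
  "rec_b L n = (if n = 0 then 0 else orth_norm L n / orth_norm L (n - 1))"

text \<open>For \<open>n > 0\<close> this is the subleading coefficient of
  \<open>orth_poly L n\<close>, since every step of the recurrence subtracts one
  \<open>rec_a\<close>.\<close>

definition rec_s :: "(real poly \<Rightarrow> real) \<Rightarrow> nat \<Rightarrow> real" where
  "rec_s L n = - (\<Sum>j<n. rec_a L j)"

lemma rec_b_0 [simp]: "rec_b L 0 = 0"
  by (simp add: rec_b_def)

lemma rec_s_0 [simp]: "rec_s L 0 = 0"
  by (simp add: rec_s_def)

lemma rec_s_Suc: "rec_s L (Suc n) = rec_s L n - rec_a L n"
  by (simp add: rec_s_def)

lemma orth_poly_Suc:
  "orth_poly L (Suc n) = pCons 0 (orth_poly L n) - smult (rec_a L n) (orth_poly L n)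
     - smult (rec_b L n) (orth_poly L (n - 1))"
  by (cases n) (simp_all add: rec_a_def rec_b_def orth_norm_def Let_def)

declare orth_poly.simps(2,3) [simp del]

lemma coeff_orth_poly_above: "n < i \<Longrightarrow> coeff (orth_poly L n) i = 0"
proof (induction n arbitrary: i rule: less_induct)
  case (less n)
  show ?case
  proof (cases n)
    case 0
    with less show ?thesis by (simp add: coeff_eq_0)
  next
    case (Suc m)
    have "coeff (orth_poly L (m - 1)) i = 0"
      using less Suc by (cases m) auto
    with less Suc show ?thesis by (cases i) (auto simp: orth_poly_Suc)
  qed
qed

lemma coeff_orth_poly_top [simp]: "coeff (orth_poly L n) n = 1"
proof (induction n)
  case (Suc n)
  have "coeff (orth_poly L (n - 1)) (Suc n) = 0" by (rule coeff_orth_poly_above) auto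
  then show ?case using Suc by (simp add: orth_poly_Suc coeff_orth_poly_above)
qed simp

lemma orth_poly_neq_0 [simp]: "orth_poly L n \<noteq> 0"
  using coeff_orth_poly_top[of L n] by (metis coeff_0 zero_neq_one)

lemma degree_orth_poly [simp]: "degree (orth_poly L n) = n"
  by (intro antisym degree_le le_degree) (auto simp: coeff_orth_poly_above)

lemma coeff_orth_poly_sub: "coeff (orth_poly L (Suc n)) n = rec_s L (Suc n)"
proof (induction n)
  case 0
  show ?case by (simp add: orth_poly_Suc[of L 0] rec_s_def)
next
  case (Suc n)
  have "coeff (orth_poly L n) (Suc n) = 0" by (rule coeff_orth_poly_above) auto
  then show ?case
    using Suc unfolding orth_poly_Suc[of L "Suc n"] rec_s_Suc[of L "Suc n"] by simp
qed

section \<open>Orthogonality and expansions for a positive functional\<close>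

locale positive_functional =
  fixes L :: "real poly \<Rightarrow> real"
  assumes L_add: "L (p + q) = L p + L q"
    and L_smult: "L (smult c p) = c * L p"
    and L_pos: "p \<noteq> 0 \<Longrightarrow> L (p * p) > 0"
begin

abbreviation P where "P \<equiv> orth_poly L"
abbreviation h where "h \<equiv> orth_norm L"
abbreviation a where "a \<equiv> rec_a L"
abbreviation \<beta> where "\<beta> \<equiv> rec_b L"
abbreviation s where "s \<equiv> rec_s L"

lemma L_0 [simp]: "L 0 = 0"
  using L_smult[of 0 0] by simp

lemma L_diff: "L (p - q) = L p - L q"
  using L_add[of "p - q" q] by simp

lemmas L_linear = L_add L_diff L_smult

lemma L_pCons_smult: "L (pCons 0 (smult c p)) = c * L (pCons 0 p)"
  using L_smult[of c "pCons 0 p"] by simp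

lemma L_pCons_pCons_add:
  "L (pCons 0 (pCons 0 (p + q))) = L (pCons 0 (pCons 0 p)) + L (pCons 0 (pCons 0 q))"
  using L_add[of "pCons 0 (pCons 0 p)" "pCons 0 (pCons 0 q)"] by simp

lemma L_pCons_pCons_smult: "L (pCons 0 (pCons 0 (smult c p))) = c * L (pCons 0 (pCons 0 p))"
  using L_smult[of c "pCons 0 (pCons 0 p)"] by simp

lemma h_pos: "h n > 0"
  unfolding orth_norm_def by (rule L_pos) simp

lemma h_neq_0 [simp]: "h n \<noteq> 0"
  using h_pos[of n] by simp

lemma \<beta>_pos: "n > 0 \<Longrightarrow> \<beta> n > 0"
  by (simp add: rec_b_def h_pos)

lemma \<beta>_Suc: "\<beta> (Suc n) = h (Suc n) / h n"
  by (simp add: rec_b_def)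

lemma L_P_P: "L (P n * P n) = h n"
  by (simp add: orth_norm_def)

lemma L_pCons_P_P: "L (pCons 0 (P n * P n)) = a n * h n"
  by (simp add: rec_a_def)

lemma pCons_P: "pCons 0 (P n) = P (Suc n) + smult (a n) (P n) + smult (\<beta> n) (P (n - 1))"
  by (simp add: orth_poly_Suc)

text \<open>The coefficients \<open>a m\<close> and \<open>\<beta> m\<close> are chosen to make
  \<open>P (Suc m)\<close> orthogonal to \<open>P m\<close> and \<open>P (m - 1)\<close>. For
  smaller \<open>i\<close> the factor t moves to \<open>P i\<close>, and \<open>pCons_P\<close>
  expands the result in polynomials of index below \<open>m\<close>.\<close>

lemma orthogonal_less: "i < n \<Longrightarrow> L (P n * P i) = 0"
proof (induction n arbitrary: i rule: less_induct)
  case (less n)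
  then obtain m where n: "n = Suc m" by (cases n) auto
  have IH: "L (P k * P i) = 0" if "i < k" "k \<le> m" for i k
    using less.IH that n by auto
  have exp: "L (P n * P i) = L (P m * pCons 0 (P i)) - a m * L (P m * P i) - \<beta> m * L (P (m - 1) * P i)"
    unfolding n orth_poly_Suc by (simp add: left_diff_distrib L_linear)
  consider "i = m" | "Suc i = m" | "Suc i < m" using less.prems n by linarith
  then show ?case
  proof cases
    case 1
    have "\<beta> m * L (P (m - 1) * P m) = 0"
      using IH[of "m - 1" m] by (cases m) (auto simp: mult.commute)
    then show ?thesis using exp 1 by (simp add: L_P_P L_pCons_P_P)
  next
    case 2
    have z: "\<beta> i * L (P m * P (i - 1)) = 0" using IH[of "i - 1" m] 2 by auto
    have "L (P m * pCons 0 (P i)) = h m"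
      unfolding pCons_P[of i] using IH[of i m] 2 z
      by (simp add: distrib_left L_linear L_P_P del: mult_eq_0_iff)
    then show ?thesis using exp IH[of i m] 2 by (auto simp: L_P_P \<beta>_Suc)
  next
    case 3
    have "L (P m * pCons 0 (P i)) = 0"
      unfolding pCons_P[of i] using IH[of i m] IH[of "i - 1" m] IH[of "Suc i" m] 3
      by (simp add: distrib_left L_linear)
    then show ?thesis using exp IH[of i m] IH[of i "m - 1"] 3 by simp
  qed
qed

lemma orthogonal: "i \<noteq> n \<Longrightarrow> L (P n * P i) = 0"
  using orthogonal_less[of i n] orthogonal_less[of n i] by (cases "i < n") (auto simp: mult.commute)

text \<open>Induction on the bound, removing the top coefficient of \<open>q\<close> by a multiple
  of \<open>P n\<close>. Bounding coefficients instead of the degree lets the case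
  \<open>n = 0\<close> mean \<open>q = 0\<close>.\<close>

lemma L_P_mult_degree_less: "(\<And>i. i \<ge> n \<Longrightarrow> coeff q i = 0) \<Longrightarrow> m \<ge> n \<Longrightarrow> L (P m * q) = 0"
proof (induction n arbitrary: q)
  case 0
  then have "q = 0" by (intro poly_eqI) auto
  then show ?case by simp
next
  case (Suc n)
  define r where "r = q - smult (coeff q n) (P n)"
  have "coeff r i = 0" if "i \<ge> n" for i
    using that Suc.prems(1)[of i] by (cases "i = n") (auto simp: r_def coeff_orth_poly_above)
  then have "L (P m * r) = 0"
    using Suc.prems(2) by (intro Suc.IH) auto
  then show ?case using Suc.prems(2) orthogonal[of n m]
    by (simp add: r_def right_diff_distrib L_linear)
qed

text \<open>Reduce \<open>q\<close> modulo \<open>P (Suc n)\<close> and \<open>P n\<close>. Removing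
  the leading term with \<open>P (Suc n)\<close> also subtracts a multiple of its subleading
  coefficient \<open>s (Suc n)\<close>, whence the correction.\<close>

lemma L_P_mult_degree_le_Suc:
  assumes "\<And>i. i > Suc n \<Longrightarrow> coeff q i = 0"
  shows "L (P n * q) = h n * (coeff q n - s (Suc n) * coeff q (Suc n))"
proof -
  define c where "c = coeff q n - s (Suc n) * coeff q (Suc n)"
  define r where "r = q - smult (coeff q (Suc n)) (P (Suc n)) - smult c (P n)"
  have "coeff r i = 0" if i: "i \<ge> n" for i
  proof -
    consider "i = n" | "i = Suc n" | "i > Suc n" using i by linarith
    then show ?thesis
      by cases (use assms in \<open>auto simp: r_def c_def coeff_orth_poly_sub coeff_orth_poly_above\<close>)
  qed
  then have "L (P n * r) = 0" by (rule L_P_mult_degree_less) auto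
  then have "L (P n * q) = c * h n" using orthogonal[of "Suc n" n]
    by (simp add: r_def right_diff_distrib L_linear L_P_P)
  then show ?thesis by (simp add: c_def mult.commute)
qed

lemma L_P_mult_degree_le:
  assumes "\<And>i. i > n \<Longrightarrow> coeff q i = 0"
  shows "L (P n * q) = h n * coeff q n"
  using L_P_mult_degree_le_Suc[of n q] assms by simp

text \<open>Such a \<open>q\<close> may be tested against itself, and \<open>L\<close> is positive
  on nonzero squares.\<close>

lemma eq_0_if_orthogonal:
  assumes "\<And>i. i \<ge> n \<Longrightarrow> coeff q i = 0"
    and "\<And>r. (\<And>i. i \<ge> n \<Longrightarrow> coeff r i = 0) \<Longrightarrow> L (q * r) = 0"
  shows "q = 0"
  using L_pos[of q] assms(2)[of q] assms(1) by (metis less_irrefl)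

text \<open>The factor \<open>\<beta> n\<close> stays on both sides so that \<open>n = 0\<close>,
  where \<open>P (n - 1)\<close> is \<open>P 0\<close>, holds trivially.\<close>

lemma L_P_pCons_pred: "\<beta> n * L (P n * pCons 0 (P (n - 1))) = \<beta> n * h n"
proof (cases n)
  case (Suc m)
  have "L (P n * pCons 0 (P m)) = h n"
    by (subst L_P_mult_degree_le) (auto simp: coeff_orth_poly_above Suc coeff_pCons split: nat.split)
  then show ?thesis by (simp add: Suc)
qed simp

lemma L_P_pred: "\<beta> n * L (P n * P (n - 1)) = 0"
  using orthogonal[of "n - 1" n] by (cases n) auto

lemma L_pCons_P_mult_pCons_P:
  "L (pCons 0 (P n) * pCons 0 (P n)) = h n * ((a n)\<^sup>2 + \<beta> (Suc n) + \<beta> n)"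
proof -
  have "L (pCons 0 (P n) * pCons 0 (P n)) = a n * L (P n * pCons 0 (P n))
      + L (P (Suc n) * pCons 0 (P n)) + \<beta> n * L (P n * pCons 0 (P (n - 1)))"
    using arg_cong[OF pCons_P[of n], of "\<lambda>p. L (p * pCons 0 (P n))"]
    unfolding distrib_right mult_smult_left L_linear
    by (simp add: mult.commute[of "P (n - Suc 0)"])
  moreover have "L (P (Suc n) * pCons 0 (P n)) = h (Suc n)"
    by (subst L_P_mult_degree_le) (auto simp: coeff_orth_poly_above coeff_pCons split: nat.split)
  moreover have "h (Suc n) = \<beta> (Suc n) * h n" by (simp add: \<beta>_Suc)
  moreover have "L (P n * pCons 0 (P n)) = a n * h n" by (simp add: L_pCons_P_P)
  ultimately show ?thesis
    by (simp only: L_P_pCons_pred) (simp add: algebra_simps power2_eq_square)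
qed

text \<open>Since \<open>\<beta> (Suc n) > 0\<close>, a common zero of two neighbours would descend
  through the recurrence to \<open>P 0 = 1\<close>.\<close>

lemma poly_P_neq_0: "poly (P n) t \<noteq> 0 \<or> poly (P (Suc n)) t \<noteq> 0"
proof (induction n)
  case (Suc n)
  then show ?case using \<beta>_pos[of "Suc n"] by (auto simp: orth_poly_Suc[of L "Suc n"])
qed simp

end


section \<open>Pearson equation, structure relation and its singular point\<close>

locale laguerre_type_functional = positive_functional +
  fixes b x :: real
  assumes pearson: "L (pCons 0 (pCons 0 (pderiv q)) + q + smult (2 - b) (pCons 0 q)
      - smult x (pCons 0 (pCons 0 q))) = 0"
begin

definition e where "e n = b - 2 * real n - 1 + x * a n"

text \<open>In degree \<open>n + 1\<close> the leading terms give n - n. In degree \<open>n\<close>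
  the subleading coefficients give (n - 1) s - n s + s with s = \<open>s n\<close>, and
  \<open>x * \<beta> n\<close> cancels between \<open>P n\<close> and t
  \<open>P (n - 1)\<close>.\<close>

lemma structure_degree:
  assumes "n > 0" "i \<ge> n"
  shows "coeff (pCons 0 (pCons 0 (pderiv (P n))) - smult (real n) (pCons 0 (P n))
    + smult (s n + x * \<beta> n) (P n) - smult (\<beta> n) (smult x (pCons 0 (P (n - 1))) + smult (e n) (P (n - 1)))) i = 0"
proof -
  obtain m where n: "n = Suc m" using assms by (cases n) auto
  obtain j where i: "i = Suc j" using assms by (cases i) auto
  consider "j = m" | "j = Suc m" | "j > Suc m" using assms n i by linarith
  then show ?thesis
  proof cases
    case 1
    then show ?thesis
      using coeff_orth_poly_above[of m "Suc m" L]
      by (cases m) (auto simp: n i coeff_pderiv coeff_orth_poly_sub coeff_pCons algebra_simps split: nat.split)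
  next
    case 2
    then show ?thesis
      by (simp add: n i coeff_pderiv coeff_orth_poly_above algebra_simps)
  next
    case 3
    then obtain l where "j = Suc l" "l > m" by (cases j) auto
    then show ?thesis
      by (simp add: n i coeff_pderiv coeff_orth_poly_above)
  qed
qed

text \<open>The Pearson equation says that the derivative of t^2 q(t) w(t) has integral 0, for w(t)
  = t^(-b) exp (-1/t - x t). Applied to \<open>p * q\<close> it is integration by parts, moving the
  derivative from \<open>p\<close> to \<open>q\<close>.\<close>

lemma L_sq_pderiv:
  "L (pCons 0 (pCons 0 (pderiv p)) * q) = x * L (p * pCons 0 (pCons 0 q)) - L (p * q)
     - (2 - b) * L (p * pCons 0 q) - L (p * pCons 0 (pCons 0 (pderiv q)))"
proof -
  have "pderiv (p * q) = pderiv p * q + p * pderiv q"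
    by (simp add: pderiv_mult)
  then show ?thesis
    using pearson[of "p * q"]
    by (simp add: L_linear mult_pCons_right L_pCons_smult L_pCons_pCons_smult L_pCons_pCons_add)
qed

text \<open>The left side minus the right side has degree below \<^term>\<open>n\<close> (this fixes the coefficients
  of \<^term>\<open>P n\<close> and the factor \<^term>\<open>x * \<beta> n\<close>) and, by the Pearson equation, is orthogonal to
  all such polynomials (this fixes \<^term>\<open>e n\<close>).\<close>

lemma structure_relation_pos:
  assumes "n > 0"
  shows "pCons 0 (pCons 0 (pderiv (P n))) = smult (real n) (pCons 0 (P n))
    - smult (s n + x * \<beta> n) (P n) + smult (\<beta> n) (smult x (pCons 0 (P (n - 1))) + smult (e n) (P (n - 1)))"
proof -
  obtain m where n: "n = Suc m" using assms by (cases n) auto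
  let ?K = "pCons 0 (pCons 0 (pderiv (P n))) - smult (real n) (pCons 0 (P n))
    + smult (s n + x * \<beta> n) (P n) - smult (\<beta> n) (smult x (pCons 0 (P (n - 1))) + smult (e n) (P (n - 1)))"
  have "?K = 0"
  proof (rule eq_0_if_orthogonal[OF structure_degree[OF assms]])
    fix r :: "real poly" assume r: "\<And>i. i \<ge> n \<Longrightarrow> coeff r i = 0"
    have r0: "coeff r i = 0" if "i > m" for i using r that n by auto
    \<comment> \<open>These are the two top coefficients of \<open>r\<close>. Reading the second one
      from \<open>pCons 0 r\<close> gives the correct value 0 when \<open>m = 0\<close>.\<close>
    define c d where "c = coeff r m" and "d = coeff (pCons 0 r) m"
    have Pn: "L (P n * r) = 0"
      by (rule L_P_mult_degree_less[OF r]) auto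
    have Pn1: "L (P n * pCons 0 r) = h n * c"
      by (subst L_P_mult_degree_le) (auto simp: c_def n r0 coeff_pCons split: nat.split)
    have Pn2: "L (P n * pCons 0 (pCons 0 r)) = h n * (d - s (Suc n) * c)"
      by (subst L_P_mult_degree_le_Suc) (auto simp: c_def d_def n r0 coeff_pCons split: nat.split)
    have Pn3: "L (P n * pCons 0 (pCons 0 (pderiv r))) = h n * (real m * c)"
      by (subst L_P_mult_degree_le) (auto simp: c_def n r0 coeff_pCons coeff_pderiv split: nat.split)
    have Pm: "L (P m * r) = h m * c"
      by (subst L_P_mult_degree_le) (auto simp: c_def r0)
    have Pm1: "L (P m * pCons 0 r) = h m * (d - s n * c)"
      by (subst L_P_mult_degree_le_Suc) (auto simp: c_def d_def n r0 coeff_pCons split: nat.split)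
    have hm: "\<beta> n * h m = h n" by (simp add: n \<beta>_Suc)
    have "L (?K * r) = x * L (P n * pCons 0 (pCons 0 r)) - L (P n * r)
        - (2 - b) * L (P n * pCons 0 r) - L (P n * pCons 0 (pCons 0 (pderiv r)))
        - real n * L (P n * pCons 0 r) + (s n + x * \<beta> n) * L (P n * r)
        - \<beta> n * (x * L (P m * pCons 0 r) + e n * L (P m * r))"
      unfolding left_diff_distrib distrib_right mult_smult_left L_linear L_sq_pderiv
      by (simp add: n)
    also have "\<dots> = h n * (x * (d - s (Suc n) * c) - (2 - b) * c - real m * c - real n * c)
        - (\<beta> n * h m) * (x * (d - s n * c) + e n * c)"
      unfolding Pn Pn1 Pn2 Pn3 Pm Pm1 by (simp add: algebra_simps)
    \<comment> \<open>The terms in \<open>d\<close> cancel, and \<open>s n - s (Suc n) = a n\<close>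
      leaves \<open>c\<close> times the difference between
      \<open>b - 2 * real n - 1 + x * a n\<close> and \<open>e n\<close>.\<close>
    also have "\<dots> = 0"
      unfolding hm by (simp add: e_def rec_s_Suc n algebra_simps)
    finally show "L (?K * r) = 0" .
  qed
  moreover have "A = B - C + D" if "A - B + C - D = 0" for A B C D :: "real poly"
    using that by (simp add: algebra_simps)
  ultimately show ?thesis by blast
qed

lemma structure_relation:
  "pCons 0 (pCons 0 (pderiv (P n))) = smult (real n) (pCons 0 (P n))
    - smult (s n + x * \<beta> n) (P n) + smult (\<beta> n) (smult x (pCons 0 (P (n - 1))) + smult (e n) (P (n - 1)))"
  using structure_relation_pos[of n] by (cases "n = 0") auto

text \<open>Trading \<open>\<beta> n * P (n - 1)\<close> for \<open>P n\<close> and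
  \<open>P (Suc n)\<close> by the recurrence. At index \<open>m\<close> this is the second row of
  the linear system for (\<open>P (Suc m)\<close>, \<open>P m\<close>).\<close>

lemma structure_relation_lower:
  "pCons 0 (pCons 0 (pderiv (P n))) = smult (real n) (pCons 0 (P n))
    - smult (s n + x * \<beta> n) (P n)
    + smult x (pCons 0 (pCons 0 (P n) - smult (a n) (P n) - P (Suc n)))
    + smult (e n) (pCons 0 (P n) - smult (a n) (P n) - P (Suc n))"
  unfolding structure_relation[of n] by (simp add: orth_poly_Suc smult_add_right mult.commute)

text \<open>The number L(P t^2 P') with P = \<open>P n\<close> is computed twice, by the structure
  relation and by the Pearson equation applied to P^2.\<close>

lemma trace_identity: "s n + x * \<beta> n + s (Suc n) + x * \<beta> (Suc n) + e n * a n = 1"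
proof -
  have b3: "L (P n * pCons 0 (P n)) = a n * h n" by (simp add: L_pCons_P_P)
  have "L (P n * pCons 0 (pCons 0 (pderiv (P n)))) = real n * L (P n * pCons 0 (P n))
      - (s n + x * \<beta> n) * L (P n * P n)
      + x * (\<beta> n * L (P n * pCons 0 (P (n - 1)))) + e n * (\<beta> n * L (P n * P (n - 1)))"
    unfolding structure_relation right_diff_distrib distrib_left mult_smult_right L_linear
    by (simp only: mult.left_commute mult.assoc)
  then have c: "L (P n * pCons 0 (pCons 0 (pderiv (P n)))) = h n * (real n * a n - s n)"
    unfolding L_P_pred L_P_pCons_pred b3 L_P_P by (simp add: algebra_simps)
  have "2 * L (P n * pCons 0 (pCons 0 (pderiv (P n))))
      = x * L (pCons 0 (P n) * pCons 0 (P n)) - h n - (2 - b) * a n * h n"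
    using L_sq_pderiv[of "P n" "P n"] mult.commute[of "pderiv (P n)" "P n"]
    by (simp add: L_pCons_P_P L_P_P)
  then have "h n * (2 * (real n * a n - s n) - x * ((a n)\<^sup>2 + \<beta> (Suc n) + \<beta> n) + 1 + (2 - b) * a n) = 0"
    unfolding L_pCons_P_mult_pCons_P c by (simp add: algebra_simps)
  then have "2 * (real n * a n - s n) - x * ((a n)\<^sup>2 + \<beta> (Suc n) + \<beta> n) + 1 + (2 - b) * a n = 0"
    by simp
  then show ?thesis by (simp add: rec_s_Suc e_def algebra_simps power2_eq_square)
qed

text \<open>The structure relations form a linear system \<open>t\<^sup>2 Y' = M(t) Y\<close> for \<open>Y = (P n, P m)\<close>.
  Since \<open>Y(0) \<noteq> 0\<close>, comparing the coefficients of \<open>t\<^sup>0\<close> and \<open>t\<^sup>1\<close> shows that \<open>det M(t)\<close>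
  vanishes to second order at \<open>t = 0\<close>; these are its two lowest coefficients.\<close>

lemma sigma_relations:
  fixes m :: nat
  defines "n \<equiv> Suc m"
  defines "G \<equiv> s n + x * \<beta> n"
  shows "G * (G - 1) = \<beta> n * e n * e m"
    and "real n * (G - 1) - (b - real n) * G + x * \<beta> n * (e n + e m) = 0"
proof -
  define y1 y0 z1 z0 where defs: "y1 = coeff (P n) 0" "y0 = coeff (P m) 0"
    "z1 = coeff (P n) 1" "z0 = coeff (P m) 1"
  have ne: "y0 \<noteq> 0 \<or> y1 \<noteq> 0"
    using poly_P_neq_0[of m 0] by (simp add: defs n_def poly_0_coeff_0)
  \<comment> \<open>The trace identity turns the constant diagonal entry of the second row into
    \<open>G - 1\<close>, so that the constant part of M(t) has trace -1.\<close>
  have tr: "s m + x * \<beta> m + e m * a m = 1 - G"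
    using trace_identity[of m] by (simp add: G_def n_def algebra_simps)
  have A: "G * y1 = \<beta> n * e n * y0"
    using arg_cong[OF structure_relation[of n], of "\<lambda>p. coeff p 0"]
    by (simp add: defs G_def n_def)
  have B: "(G - 1) * y0 = e m * y1"
  proof -
    have "(s m + x * \<beta> m + e m * a m) * y0 + e m * y1 = 0"
      using arg_cong[OF structure_relation_lower[of m], of "\<lambda>p. coeff p 0"]
      by (simp add: defs n_def algebra_simps)
    then show ?thesis unfolding tr by (simp add: algebra_simps)
  qed
  have C: "real n * y1 - G * z1 + \<beta> n * (x * y0 + e n * z0) = 0"
    using arg_cong[OF structure_relation[of n], of "\<lambda>p. coeff p 1"]
    by (simp add: defs G_def n_def)
  have D: "(b - real n) * y0 + (G - 1) * z0 - x * y1 - e m * z1 = 0"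
  proof -
    have "real m * y0 - (s m + x * \<beta> m) * z0 + x * (- a m * y0 - y1) + e m * (y0 - a m * z0 - z1) = 0"
      using arg_cong[OF structure_relation_lower[of m], of "\<lambda>p. coeff p 1"]
      by (simp add: defs n_def)
    moreover have "(G - 1) * z0 = - (s m + x * \<beta> m) * z0 - e m * a m * z0"
    proof -
      have "G - 1 = - (s m + x * \<beta> m) - e m * a m" using tr by simp
      then show ?thesis by (simp only: left_diff_distrib)
    qed
    ultimately show ?thesis by (simp add: n_def e_def algebra_simps)
  qed
  \<comment> \<open>\<open>K\<close> is -det M(0). Multiplying \<open>A\<close> and \<open>B\<close>
    by the adjugate of M(0) yields K Y(0) = 0.\<close>
  define K where "K = G * (G - 1) - \<beta> n * e n * e m"
  have "K * y1 = (G - 1) * (G * y1 - \<beta> n * e n * y0) + \<beta> n * e n * ((G - 1) * y0 - e m * y1)"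
    "K * y0 = G * ((G - 1) * y0 - e m * y1) + e m * (G * y1 - \<beta> n * e n * y0)"
    by (simp_all add: K_def algebra_simps)
  then have "K * y1 = 0" "K * y0 = 0" unfolding A B by simp_all
  then have K: "K = 0" using ne by auto
  then show "G * (G - 1) = \<beta> n * e n * e m" by (simp add: K_def)
  \<comment> \<open>\<open>T\<close> is the coefficient of t in det M(t). The same adjugate, applied
    to the first-order equations \<open>C\<close> and \<open>D\<close>, gives T Y(0) = 0 up to
    multiples of \<open>A\<close>, \<open>B\<close> and \<open>K\<close>.\<close>
  define T where "T = real n * (G - 1) - (b - real n) * G + x * \<beta> n * (e n + e m)"
  define C' where "C' = real n * y1 - G * z1 + \<beta> n * (x * y0 + e n * z0)"
  define D' where "D' = (b - real n) * y0 + (G - 1) * z0 - x * y1 - e m * z1"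
  have "T * y1 = (G - 1) * C' - \<beta> n * e n * D' + K * z1
      - \<beta> n * x * ((G - 1) * y0 - e m * y1) - (b - real n) * (G * y1 - \<beta> n * e n * y0)"
    "T * y0 = e m * C' - G * D' + K * z0
      + real n * ((G - 1) * y0 - e m * y1) - x * (G * y1 - \<beta> n * e n * y0)"
    by (simp_all add: T_def C'_def D'_def K_def algebra_simps)
  then have "T * y1 = 0" "T * y0 = 0"
    unfolding A B K C[folded C'_def] D[folded D'_def] by simp_all
  then show "real n * (G - 1) - (b - real n) * G + x * \<beta> n * (e n + e m) = 0"
    using ne by (auto simp: T_def)
qed

end

section \<open>Deformation of the functional\<close>

text \<open>This differentiates in the deformation parameter; the derivative in the variable of the
  polynomial is \<open>pderiv\<close>.\<close>

definition has_coeff_derivative :: "(real \<Rightarrow> real poly) \<Rightarrow> real poly \<Rightarrow> real \<Rightarrow> bool" where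
  "has_coeff_derivative G G' x \<longleftrightarrow>
     (\<forall>i. ((\<lambda>y. coeff (G y) i) has_real_derivative coeff G' i) (at x))"

lemma has_coeff_derivative_const: "has_coeff_derivative (\<lambda>y. p) 0 x"
  by (simp add: has_coeff_derivative_def)

lemma has_coeff_derivative_diff:
  "has_coeff_derivative F F' x \<Longrightarrow> has_coeff_derivative G G' x \<Longrightarrow>
    has_coeff_derivative (\<lambda>y. F y - G y) (F' - G') x"
  by (auto simp: has_coeff_derivative_def intro!: DERIV_diff)

lemma has_coeff_derivative_pCons:
  "has_coeff_derivative F F' x \<Longrightarrow> has_coeff_derivative (\<lambda>y. pCons 0 (F y)) (pCons 0 F') x"
  by (auto simp: has_coeff_derivative_def coeff_pCons split: nat.split)

lemma has_coeff_derivative_smult: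
  "(c has_real_derivative c') (at x) \<Longrightarrow> has_coeff_derivative F F' x \<Longrightarrow>
    has_coeff_derivative (\<lambda>y. smult (c y) (F y)) (smult c' (F x) + smult (c x) F') x"
  unfolding has_coeff_derivative_def by (auto intro!: derivative_eq_intros)

lemma has_coeff_derivative_mult:
  "has_coeff_derivative F F' x \<Longrightarrow> has_coeff_derivative G G' x \<Longrightarrow>
    has_coeff_derivative (\<lambda>y. F y * G y) (F' * G x + F x * G') x"
  unfolding has_coeff_derivative_def coeff_mult coeff_add sum.distrib[symmetric]
  by (intro allI DERIV_sum) (auto intro!: derivative_eq_intros)

text \<open>Modelled on the integral of p(t) exp (-y t) against a fixed measure: differentiating in
  y inserts the factor -t.\<close>

locale laplace_family =
  fixes L :: "real \<Rightarrow> real poly \<Rightarrow> real"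
  assumes pos: "x > 0 \<Longrightarrow> positive_functional (L x)"
    and L_deriv: "x > 0 \<Longrightarrow> ((\<lambda>y. L y p) has_real_derivative - L x (pCons 0 p)) (at x)"
begin

lemma L_eq_sum:
  assumes "x > 0" "\<And>i. i > N \<Longrightarrow> coeff p i = 0"
  shows "L x p = (\<Sum>i\<le>N. coeff p i * L x (monom 1 i))"
proof -
  interpret positive_functional "L x" by (rule pos) fact
  have sum: "L x (\<Sum>i\<in>A. f i) = (\<Sum>i\<in>A. L x (f i))" if "finite A" for A and f :: "nat \<Rightarrow> real poly"
    using that by induction (auto simp: L_add)
  have "p = (\<Sum>i\<le>N. smult (coeff p i) (monom 1 i))"
    using assms(2) by (intro poly_eqI) (auto simp: coeff_sum coeff_monom if_distrib not_le sum.delta cong: if_cong)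
  then have "L x p = L x (\<Sum>i\<le>N. smult (coeff p i) (monom 1 i))" by simp
  then show ?thesis by (simp only: sum finite_atMost L_smult)
qed

text \<open>Product rule for a functional and a polynomial that both move. The degree bound
  \<open>N\<close>, uniform in \<open>y\<close>, reduces it to a fixed finite sum over
  moments.\<close>

lemma has_real_derivative_L:
  assumes x: "x > 0" and G: "has_coeff_derivative G G' x"
    and deg: "\<And>y i. i > N \<Longrightarrow> coeff (G y) i = 0"
  shows "((\<lambda>y. L y (G y)) has_real_derivative L x G' - L x (pCons 0 (G x))) (at x)"
proof -
  interpret positive_functional "L x" by (rule pos) fact
  have deg': "coeff G' i = 0" if "i > N" for i
  proof (rule DERIV_unique)
    show "((\<lambda>y. coeff (G y) i) has_real_derivative coeff G' i) (at x)"
      using G by (simp add: has_coeff_derivative_def)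
  qed (simp add: deg[OF that])
  have "((\<lambda>y. \<Sum>i\<le>N. coeff (G y) i * L y (monom 1 i)) has_real_derivative
      (\<Sum>i\<le>N. coeff G' i * L x (monom 1 i) + - L x (pCons 0 (monom 1 i)) * coeff (G x) i)) (at x)"
    using G unfolding has_coeff_derivative_def
    by (intro DERIV_sum DERIV_mult L_deriv x) auto
  moreover have "(\<Sum>i\<le>N. coeff G' i * L x (monom 1 i) + - L x (pCons 0 (monom 1 i)) * coeff (G x) i)
      = L x G' - L x (pCons 0 (G x))"
  proof -
    have "L x (pCons 0 (G x)) = (\<Sum>i\<le>Suc N. coeff (pCons 0 (G x)) i * L x (monom 1 i))"
      using deg by (intro L_eq_sum x) (auto simp: coeff_pCons split: nat.split)
    also have "\<dots> = (\<Sum>i\<le>N. coeff (G x) i * L x (pCons 0 (monom 1 i)))"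
      by (subst sum.atMost_Suc_shift) (simp add: monom_Suc)
    finally show ?thesis
      using L_eq_sum[OF x deg', of N] by (simp add: sum.distrib sum_negf sum_subtractf algebra_simps)
  qed
  ultimately have "((\<lambda>y. \<Sum>i\<le>N. coeff (G y) i * L y (monom 1 i)) has_real_derivative
      L x G' - L x (pCons 0 (G x))) (at x)" by simp
  moreover have "\<forall>\<^sub>F y in nhds x. (\<Sum>i\<le>N. coeff (G y) i * L y (monom 1 i)) = L y (G y)"
    using eventually_nhds_in_open[of "{0<..}" x] x
    by (auto elim!: eventually_mono simp: L_eq_sum[symmetric] deg)
  ultimately show ?thesis
    by (subst DERIV_cong_ev[OF refl _ refl, symmetric]) auto
qed

section \<open>Toda equations for the recurrence coefficients\<close>

abbreviation Pf where "Pf n x \<equiv> orth_poly (L x) n"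
abbreviation hf where "hf n x \<equiv> orth_norm (L x) n"
abbreviation af where "af n x \<equiv> rec_a (L x) n"
abbreviation \<beta>f where "\<beta>f n x \<equiv> rec_b (L x) n"
abbreviation sf where "sf n x \<equiv> rec_s (L x) n"

text \<open>The derivative of \<open>Pf n\<close> is a multiple of \<open>Pf (n - 1)\<close>, hence
  orthogonal to \<open>Pf n\<close>, so only the moving functional contributes to \<open>h'\<close>.
  For \<open>a\<close> the quotient rule is applied, where this derivative contributes twice
  \<open>\<beta>f n x * hf n x\<close>.\<close>

lemma
  assumes x: "x > 0"
    and Pf: "has_coeff_derivative (Pf n) (smult (\<beta>f n x) (Pf (n - 1) x)) x"
  shows h_deriv_aux: "((hf n) has_real_derivative - af n x * hf n x) (at x)"
    and a_deriv_aux: "((af n) has_real_derivative \<beta>f n x - \<beta>f (Suc n) x) (at x)"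
proof -
  interpret positive_functional "L x" by (rule pos) fact
  let ?Q = "smult (\<beta>f n x) (Pf (n - 1) x)"
  have deg: "coeff (Pf n y * Pf n y) i = 0" if "i > 2 * n" for y i
    by (rule coeff_eq_0) (use that in \<open>simp add: degree_mult_eq\<close>)
  have D: "has_coeff_derivative (\<lambda>y. Pf n y * Pf n y) (?Q * Pf n x + Pf n x * ?Q) x"
    by (intro has_coeff_derivative_mult Pf)
  have "L x (?Q * Pf n x + Pf n x * ?Q) = 2 * (\<beta>f n x * L x (Pf n x * Pf (n - 1) x))"
    unfolding mult.commute[of ?Q] mult_smult_right L_linear by simp
  then show h': "((hf n) has_real_derivative - af n x * hf n x) (at x)"
    using has_real_derivative_L[OF x D deg] unfolding L_P_pred L_pCons_P_P
    by (simp add: orth_norm_def)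
  have deg': "coeff (pCons 0 (Pf n y * Pf n y)) i = 0" if "i > Suc (2 * n)" for y i
    using that deg by (auto simp: coeff_pCons split: nat.split)
  have "L x (pCons 0 (?Q * Pf n x + Pf n x * ?Q)) = 2 * (\<beta>f n x * L x (Pf n x * pCons 0 (Pf (n - 1) x)))"
    using L_pCons_smult[of "\<beta>f n x"] L_add[of "pCons 0 (?Q * Pf n x)" "pCons 0 (Pf n x * ?Q)"]
    unfolding mult.commute[of ?Q] mult_smult_right by simp
  moreover have "L x (pCons 0 (pCons 0 (Pf n x * Pf n x))) = hf n x * ((af n x)\<^sup>2 + \<beta>f (Suc n) x + \<beta>f n x)"
    using L_pCons_P_mult_pCons_P[of n] by simp
  ultimately have "L x (pCons 0 (?Q * Pf n x + Pf n x * ?Q)) - L x (pCons 0 (pCons 0 (Pf n x * Pf n x)))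
      = hf n x * (\<beta>f n x - \<beta>f (Suc n) x - (af n x)\<^sup>2)"
    unfolding L_P_pCons_pred by (simp add: algebra_simps)
  then have ah: "((\<lambda>y. L y (pCons 0 (Pf n y * Pf n y))) has_real_derivative
      hf n x * (\<beta>f n x - \<beta>f (Suc n) x - (af n x)\<^sup>2)) (at x)"
    using has_real_derivative_L[OF x has_coeff_derivative_pCons[OF D] deg'] by metis
  have "((\<lambda>y. L y (pCons 0 (Pf n y * Pf n y)) / hf n y) has_real_derivative
      \<beta>f n x - \<beta>f (Suc n) x) (at x)"
    by (rule derivative_eq_intros ah h' h_neq_0)+
      (simp add: L_pCons_P_P field_simps power2_eq_square)
  then show "((af n) has_real_derivative \<beta>f n x - \<beta>f (Suc n) x) (at x)"
    by (simp add: rec_a_def[abs_def])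
qed

lemma b_deriv_aux:
  assumes x: "x > 0"
    and hn: "((hf n) has_real_derivative - af n x * hf n x) (at x)"
    and hm: "((hf (n - 1)) has_real_derivative - af (n - 1) x * hf (n - 1) x) (at x)"
  shows "((\<beta>f n) has_real_derivative \<beta>f n x * (af (n - 1) x - af n x)) (at x)"
proof (cases n)
  case (Suc m)
  interpret positive_functional "L x" by (rule pos) fact
  have "((\<lambda>y. hf n y / hf (n - 1) y) has_real_derivative \<beta>f n x * (af (n - 1) x - af n x)) (at x)"
    by (rule derivative_eq_intros hn hm h_neq_0)+
      (simp add: rec_b_def Suc field_simps power2_eq_square)
  then show ?thesis by (simp add: rec_b_def[abs_def] Suc)
qed (simp add: rec_b_def)

text \<open>The Toda flow: the derivative of \<open>P n\<close> and those of the recurrence coefficients have to be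
  obtained by a simultaneous induction.\<close>

lemma P_deriv:
  assumes x: "x > 0"
  shows "has_coeff_derivative (Pf n) (smult (\<beta>f n x) (Pf (n - 1) x)) x"
proof (induction n rule: less_induct)
  case (less n)
  show ?case
  proof (cases n)
    case 0
    then show ?thesis by (simp add: has_coeff_derivative_const)
  next
    case (Suc m)
    have Pm: "has_coeff_derivative (Pf m) (smult (\<beta>f m x) (Pf (m - 1) x)) x"
      and Pl: "has_coeff_derivative (Pf (m - 1)) (smult (\<beta>f (m - 1) x) (Pf (m - 1 - 1) x)) x"
      using less.IH[of m] less.IH[of "m - 1"] Suc by auto
    note a' = a_deriv_aux[OF x Pm]
    note b' = b_deriv_aux[OF x h_deriv_aux[OF x Pm] h_deriv_aux[OF x Pl]]
    have "has_coeff_derivative (Pf n)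
        (pCons 0 (smult (\<beta>f m x) (Pf (m - 1) x))
          - (smult (\<beta>f m x - \<beta>f (Suc m) x) (Pf m x) + smult (af m x) (smult (\<beta>f m x) (Pf (m - 1) x)))
          - (smult (\<beta>f m x * (af (m - 1) x - af m x)) (Pf (m - 1) x)
             + smult (\<beta>f m x) (smult (\<beta>f (m - 1) x) (Pf (m - 1 - 1) x)))) x" (is "has_coeff_derivative _ ?D _")
      unfolding Suc orth_poly_Suc
      by (intro has_coeff_derivative_diff has_coeff_derivative_pCons has_coeff_derivative_smult Pm Pl a' b')
    \<comment> \<open>Expanding t \<open>Pf (m - 1)\<close> by the recurrence cancels everything
      except the term \<open>\<beta>f (Suc m) x\<close> times \<open>Pf m x\<close>.\<close>
    also have "?D = smult (\<beta>f n x) (Pf (n - 1) x)"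
    proof (cases m)
      case 0
      then show ?thesis by (simp add: Suc)
    next
      case (Suc k)
      then have "pCons 0 (Pf (m - 1) x) = Pf m x + smult (af (m - 1) x) (Pf (m - 1) x) + smult (\<beta>f (m - 1) x) (Pf (m - 1 - 1) x)"
        by (simp add: orth_poly_Suc[of _ k])
      then have "pCons 0 (smult (\<beta>f m x) (Pf (m - 1) x))
          = smult (\<beta>f m x) (Pf m x + smult (af (m - 1) x) (Pf (m - 1) x) + smult (\<beta>f (m - 1) x) (Pf (m - 1 - 1) x))"
        by (metis smult_pCons mult_zero_right)
      then show ?thesis
        by (simp add: \<open>n = Suc m\<close> smult_add_right smult_diff_left algebra_simps)
    qed
    finally show ?thesis .
  qed
qed

lemma h_deriv: "x > 0 \<Longrightarrow> ((hf n) has_real_derivative - af n x * hf n x) (at x)"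
  by (intro h_deriv_aux P_deriv)

lemma a_deriv: "x > 0 \<Longrightarrow> ((af n) has_real_derivative \<beta>f n x - \<beta>f (Suc n) x) (at x)"
  by (intro a_deriv_aux P_deriv)

lemma b_deriv: "x > 0 \<Longrightarrow> ((\<beta>f n) has_real_derivative \<beta>f n x * (af (n - 1) x - af n x)) (at x)"
  by (intro b_deriv_aux h_deriv)

text \<open>The derivatives of the \<open>a\<close> are differences of consecutive
  \<open>\<beta>\<close>, so the sum telescopes.\<close>

lemma s_deriv:
  assumes x: "x > 0"
  shows "((sf n) has_real_derivative \<beta>f n x) (at x)"
proof (induction n)
  case (Suc n)
  show ?case
    unfolding rec_s_Suc by (rule derivative_eq_intros Suc a_deriv x)+ simp
qed (simp add: rec_s_def)

end

section \<open>The differential equation for the abstract family\<close>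

locale laguerre_type_family = laplace_family +
  fixes b :: real
  assumes laguerre: "x > 0 \<Longrightarrow> laguerre_type_functional (L x) b x"
begin

theorem sigma_form:
  fixes n :: nat
  defines "S \<equiv> (\<lambda>y. y * sf n y)"
  assumes x: "x > 0" and n: "n \<ge> 1"
  defines "S' \<equiv> sf n x + x * \<beta>f n x"
  obtains S'' where "(S has_real_derivative S') (at x)"
    and "((\<lambda>y. sf n y + y * \<beta>f n y) has_real_derivative S'') (at x)"
    and "(x * S'')\<^sup>2 = 4 * S x * (S'\<^sup>2 - S') - (4 * x * S'\<^sup>2 - (4 * x + (b - 2 * real n)\<^sup>2) * S'
           - 2 * real n * (b - 2 * real n)) * S' + (real n)\<^sup>2"
proof
  interpret laguerre_type_functional "L x" b x by (rule laguerre) fact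
  let ?E = "e n - e (n - 1)"
  show "(S has_real_derivative S') (at x)"
    unfolding S_def S'_def
    using DERIV_mult[OF DERIV_ident s_deriv[OF x, of n]] by (simp add: mult.commute)
  \<comment> \<open>The derivative is \<open>\<beta>f n x\<close> times 2 + x (a_{n-1} - a_n); the 2
    comes from \<open>s'\<close> and the product rule, and matches the summand -2n in
    \<open>e\<close>.\<close>
  show "((\<lambda>y. sf n y + y * \<beta>f n y) has_real_derivative - (\<beta>f n x * ?E)) (at x)"
    using DERIV_add[OF s_deriv[OF x, of n] DERIV_mult[OF DERIV_ident b_deriv[OF x, of n]]] n by (simp add: e_def of_nat_diff algebra_simps)
  let ?B = "x * \<beta>f n x"
  have r1: "S' * (S' - 1) = \<beta>f n x * e n * e (n - 1)"
    and r2: "?B * (e n + e (n - 1)) = (b - real n) * S' - real n * (S' - 1)"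
    using sigma_relations[of "n - 1"] n by (simp_all add: S'_def algebra_simps)
  have xB: "x * ?B = x * S' - S x" by (simp add: S_def S'_def algebra_simps)
  have "(x * - (\<beta>f n x * ?E))\<^sup>2 = (?B * (e n + e (n - 1)))\<^sup>2 - 4 * (x * ?B) * (\<beta>f n x * e n * e (n - 1))"
    by (simp add: power2_eq_square algebra_simps)
  also have "\<dots> = ((b - real n) * S' - real n * (S' - 1))\<^sup>2 - 4 * (x * S' - S x) * (S' * (S' - 1))"
    unfolding r1[symmetric] r2 xB ..
  also have "\<dots> = 4 * S x * (S'\<^sup>2 - S') - (4 * x * S'\<^sup>2 - (4 * x + (b - 2 * real n)\<^sup>2) * S'
           - 2 * real n * (b - 2 * real n)) * S' + (real n)\<^sup>2"
    by (simp add: power2_eq_square algebra_simps)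
  finally show "(x * - (\<beta>f n x * ?E))\<^sup>2 = 4 * S x * (S'\<^sup>2 - S') - (4 * x * S'\<^sup>2 - (4 * x + (b - 2 * real n)\<^sup>2) * S'
           - 2 * real n * (b - 2 * real n)) * S' + (real n)\<^sup>2" .
qed

end

section \<open>The weight\<close>

text \<open>Extension by 0 turns integrals over the half-line into integrals over the whole line, so
  restricting to the positive orthant needs no separate indicator.\<close>

definition lag_weight :: "real \<Rightarrow> real \<Rightarrow> real \<Rightarrow> real" where
  "lag_weight b x t = (if t > 0 then t powr (- b) * exp (- 1 / t - x * t) else 0)"

definition lag_fun :: "real \<Rightarrow> real \<Rightarrow> real poly \<Rightarrow> real" where
  "lag_fun b x p = (\<integral>t. poly p t * lag_weight b x t \<partial>lborel)"

section \<open>Integrability of the moments\<close>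

lemma lag_weight_nonneg: "lag_weight b x t \<ge> 0"
  by (simp add: lag_weight_def)

lemma lag_weight_measurable [measurable]: "lag_weight b x \<in> borel_measurable borel"
  unfolding lag_weight_def by measurable

text \<open>Keep one term of the series of exp (1/t). The bound absorbs any negative power of t at
  the origin.\<close>

lemma exp_minus_inverse_le:
  fixes t :: real
  assumes "t > 0"
  shows "exp (- 1 / t) \<le> fact N * t ^ N"
proof -
  have "(1 / t) ^ N / fact N \<le> (\<Sum>i. inverse (fact i) *\<^sub>R (1 / t) ^ i)"
    using assms sum_le_suminf[OF summable_exp_generic[of "1 / t"], of "{N}"]
    by (auto simp: divide_inverse mult.commute)
  then have "(1 / t) ^ N / fact N \<le> exp (1 / t)"
    by (simp add: exp_def)
  then have "1 / exp (1 / t) \<le> 1 / ((1 / t) ^ N / fact N)"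
    using assms by (intro divide_left_mono) auto
  then show ?thesis
    using assms by (simp add: exp_minus divide_simps power_divide mult_ac)
qed

lemma integrable_powr_exp:
  assumes "c \<ge> 0" "x > 0"
  shows "integrable lborel (\<lambda>t::real. indicator {0<..} t * (t powr c * exp (- (x * t))))"
proof -
  have "(\<lambda>t. complex_of_real t powr (of_real (c + 1) - 1) / of_real (exp (x * t)))
      absolutely_integrable_on {0<..}"
    using assms by (intro absolutely_integrable_Gamma_integral) auto
  then have "integrable lebesgue (\<lambda>t. norm (indicator {0<..} t *\<^sub>R
      (complex_of_real t powr (of_real (c + 1) - 1) / of_real (exp (x * t)))))"
    unfolding set_integrable_def by (rule integrable_norm)
  also have "(\<lambda>t. norm (indicator {0<..} t *\<^sub>R
      (complex_of_real t powr (of_real (c + 1) - 1) / of_real (exp (x * t)))))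
      = (\<lambda>t::real. indicator {0<..} t * (t powr c * exp (- (x * t))))"
    by (auto simp: fun_eq_iff indicator_def norm_divide norm_mult norm_inverse norm_powr_real_powr exp_minus divide_inverse)
  finally show ?thesis
    by (subst integrable_completion[symmetric]) auto
qed

lemma power_mult_lag_weight:
  "t ^ k * lag_weight b x t = (if t > 0 then t powr (real k - b) * exp (- 1 / t) * exp (- (x * t)) else 0)"
proof -
  have "exp (- 1 / t - x * t) = exp (- 1 / t) * exp (- (x * t))"
    by (simp add: exp_add[symmetric])
  moreover have "t powr (real k - b) = t ^ k * t powr (- b)" if "t > 0"
    using that by (simp add: powr_realpow[symmetric] powr_add[symmetric])
  ultimately show ?thesis by (simp add: lag_weight_def)
qed

lemma integrable_power_lag_weight:
  assumes "x > 0"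
  shows "integrable lborel (\<lambda>t. t ^ k * lag_weight b x t)"
proof -
  \<comment> \<open>Large enough to make the exponent \<open>real N - b + real k\<close>
    nonnegative, so that a Gamma integrand dominates.\<close>
  define N where "N = nat \<lceil>b\<rceil>"
  have N: "real N - b + real k \<ge> 0" by (simp add: N_def) linarith
  show ?thesis
  proof (rule Bochner_Integration.integrable_bound)
    show "integrable lborel (\<lambda>t. fact N * (indicator {0<..} t * (t powr (real N - b + real k) * exp (- (x * t)))))"
      by (intro integrable_mult_right integrable_powr_exp N assms)
    have "t powr (real k - b) * exp (- 1 / t) * exp (- (x * t))
        \<le> fact N * (t powr (real N - b + real k) * exp (- (x * t)))" if "t > 0" for t
    proof -
      have "t powr (real k - b) * exp (- 1 / t) \<le> t powr (real k - b) * (fact N * t ^ N)"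
        by (intro mult_left_mono exp_minus_inverse_le that) auto
      also have "\<dots> = fact N * t powr (real N - b + real k)"
        using that by (simp add: powr_realpow[symmetric] powr_add[symmetric] algebra_simps)
      finally show ?thesis by (simp add: mult_right_mono mult.assoc[symmetric])
    qed
    then show "AE t in lborel. norm (t ^ k * lag_weight b x t)
        \<le> norm (fact N * (indicator {0<..} t * (t powr (real N - b + real k) * exp (- (x * t)))))"
      by (intro AE_I2) (auto simp: power_mult_lag_weight)
  qed measurable
qed

text \<open>At parameter 0 the exponential decay at infinity is lost. The exponent bound supplies
  decay like t^(-2) instead, and a multiple of 1 / (1 + t^2) dominates on both sides of t =
  1.\<close>

lemma integrable_power_lag_weight_0:
  assumes "real k - b \<le> - 2"
  shows "integrable lborel (\<lambda>t. t ^ k * lag_weight b 0 t)"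
proof -
  define N where "N = nat \<lceil>b\<rceil>"
  have N: "real N - b + real k \<ge> 0" by (simp add: N_def) linarith
  have int: "integrable lborel (\<lambda>t::real. inverse (1 + t\<^sup>2))"
    using integrable_inverse_1_plus_square by (simp add: set_integrable_def)
  show ?thesis
  proof (rule Bochner_Integration.integrable_bound)
    show "integrable lborel (\<lambda>t. 2 * fact N * inverse (1 + t\<^sup>2) :: real)"
      by (intro integrable_mult_right int)
    have "t powr (real k - b) * exp (- 1 / t) \<le> 2 * fact N * inverse (1 + t\<^sup>2)" if "t > 0" for t
    proof (cases "t \<le> 1")
      case True
      have "t powr (real k - b) * exp (- 1 / t) \<le> t powr (real k - b) * (fact N * t ^ N)"
        by (intro mult_left_mono exp_minus_inverse_le that) auto
      also have "\<dots> = fact N * t powr (real N - b + real k)"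
        using that by (simp add: powr_realpow[symmetric] powr_add[symmetric] algebra_simps)
      also have "\<dots> \<le> fact N * 1"
        using that True N by (intro mult_left_mono powr_le1) auto
      also have "\<dots> \<le> fact N * (2 * inverse (1 + t\<^sup>2))"
        using that True power_le_one[of t 2] by (intro mult_left_mono) (auto simp: divide_inverse[symmetric] pos_le_divide_eq add_pos_nonneg)
      finally show ?thesis by (simp add: mult_ac)
    next
      case False
      have "t powr (real k - b) * exp (- 1 / t) \<le> t powr (- 2) * 1"
        using False assms by (intro mult_mono powr_mono) auto
      also have "\<dots> = inverse (t\<^sup>2)" using that by (simp add: powr_minus powr_numeral)
      also have "\<dots> = 2 * inverse (2 * t\<^sup>2)" using that by simp
      also have "\<dots> \<le> 2 * inverse (1 + t\<^sup>2)"
        using False one_le_power[of t 2]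
        by (intro mult_left_mono le_imp_inverse_le) (auto intro: add_pos_nonneg)
      also have "\<dots> \<le> fact N * (2 * inverse (1 + t\<^sup>2))"
        using mult_right_mono[OF fact_ge_1[of N, where ?'a = real], of "2 * inverse (1 + t\<^sup>2)"] by simp
      finally show ?thesis by (simp add: mult_ac)
    qed
    then show "AE t in lborel. norm (t ^ k * lag_weight b 0 t) \<le> norm (2 * fact N * inverse (1 + t\<^sup>2) :: real)"
      by (intro AE_I2) (auto simp: power_mult_lag_weight)
  qed measurable
qed

lemma integrable_poly_lag_weight:
  assumes "x > 0"
  shows "integrable lborel (\<lambda>t. poly p t * lag_weight b x t)"
  unfolding poly_altdef sum_distrib_right mult.assoc
  by (intro Bochner_Integration.integrable_sum integrable_mult_right integrable_power_lag_weight assms)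

section \<open>Positivity of the functional\<close>

lemma emeasure_greaterThan_neq_0: "emeasure lborel {0::real<..} \<noteq> 0"
proof
  assume "emeasure lborel {0::real<..} = 0"
  moreover have "emeasure lborel {0::real<..<1} \<le> emeasure lborel {0::real<..}"
    by (intro emeasure_mono) auto
  ultimately show False by simp
qed

text \<open>If the integral were 0, the integrand would vanish almost everywhere; as
  \<open>p\<close> has finitely many roots, the positive half-line would be a null set.\<close>

lemma lag_fun_pos:
  assumes x: "x > 0" and p: "p \<noteq> 0"
  shows "lag_fun b x (p * p) > 0"
proof -
  have nn: "AE t in lborel. 0 \<le> poly (p * p) t * lag_weight b x t"
    by (intro AE_I2) (simp add: lag_weight_nonneg)
  have "lag_fun b x (p * p) \<noteq> 0"
  proof
    assume "lag_fun b x (p * p) = 0"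
    then have "AE t in lborel. poly (p * p) t * lag_weight b x t = 0"
      using integral_nonneg_eq_0_iff_AE[OF integrable_poly_lag_weight[OF x] nn]
      by (simp add: lag_fun_def)
    moreover have "AE t in lborel. t \<notin> {t. poly p t = 0}"
      using finite_imp_null_set_lborel[OF poly_roots_finite[OF p]] by (rule AE_not_in)
    ultimately have "AE t in lborel. t \<notin> {0::real<..}"
      by eventually_elim (auto simp: lag_weight_def)
    then show False
      using emeasure_greaterThan_neq_0 by (subst (asm) AE_iff_null) (auto simp: null_sets_def greaterThan_def)
  qed
  moreover have "lag_fun b x (p * p) \<ge> 0"
    unfolding lag_fun_def by (rule integral_nonneg_AE[OF nn])
  ultimately show ?thesis by simp
qed

lemma positive_functional_lag_fun:
  assumes "x > 0"
  shows "positive_functional (lag_fun b x)"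
proof
  show "lag_fun b x (p + q) = lag_fun b x p + lag_fun b x q" for p q
    unfolding lag_fun_def poly_add distrib_right
    by (intro Bochner_Integration.integral_add integrable_poly_lag_weight assms)
  show "lag_fun b x (smult c p) = c * lag_fun b x p" for c p
    by (simp add: lag_fun_def mult.assoc)
qed (rule lag_fun_pos[OF assms])

section \<open>Differentiation under the integral sign\<close>

lemma exp_second_order_bound:
  fixes u :: real
  shows "\<bar>exp u - 1 - u\<bar> \<le> u\<^sup>2 * exp \<bar>u\<bar>"
proof -
  obtain v where v: "\<bar>v\<bar> \<le> \<bar>u\<bar>" "exp u = (\<Sum>m<2. u ^ m / fact m) + exp v / fact 2 * u ^ 2"
    using Maclaurin_exp_le[of u 2] by blast
  then have "\<bar>exp u - 1 - u\<bar> = u\<^sup>2 * (exp v / 2)"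
    by (simp add: numeral_2_eq_2 abs_mult)
  also have "exp v / 2 \<le> exp \<bar>u\<bar>"
    using v(1) exp_le_cancel_iff[of v "\<bar>u\<bar>"] by (smt (verit) exp_gt_zero field_sum_of_halves)
  finally show ?thesis by (simp add: mult_left_mono)
qed

text \<open>The second-order remainder of exp (-d t), integrated against the weight, bounds the
  error of the difference quotient by a constant times |d|.\<close>

lemma lag_fun_deriv:
  assumes x: "x > 0"
  shows "((\<lambda>y. lag_fun b y p) has_real_derivative - lag_fun b x (pCons 0 p)) (at x)"
proof -
  let ?w = "lag_weight b"
  let ?q = "pCons 0 (pCons 0 p)"
  \<comment> \<open>The parameter \<open>x / 2\<close> leaves room for the remainder: for |d| < x/2
    the factor exp |d t| uses up at most half of the decay exp (-x t).\<close>
  define C where "C = (\<integral>t. \<bar>poly ?q t * ?w (x / 2) t\<bar> \<partial>lborel)"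
  have "((\<lambda>d. (lag_fun b (x + d) p - lag_fun b x p) / d - (- lag_fun b x (pCons 0 p))) \<longlongrightarrow> 0) (at 0)"
  proof (rule Lim_null_comparison)
    have bound: "norm ((lag_fun b (x + d) p - lag_fun b x p) / d - - lag_fun b x (pCons 0 p)) \<le> \<bar>d\<bar> * C"
      if "d \<noteq> 0 \<and> \<bar>d\<bar> < x / 2" for d
    proof -
      have d: "d \<noteq> 0" "\<bar>d\<bar> < x / 2" using that by auto
      have xd: "x + d > 0" "x / 2 > 0" using d x by linarith+
      note i1 = integrable_poly_lag_weight[OF xd(1), of p b]
      note i2 = integrable_poly_lag_weight[OF x, of p b]
      have i3: "integrable lborel (\<lambda>t. d * (poly (pCons 0 p) t * ?w x t))"
        by (intro integrable_mult_right integrable_poly_lag_weight x)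
      have eq: "lag_fun b (x + d) p - lag_fun b x p + d * lag_fun b x (pCons 0 p)
          = (\<integral>t. poly p t * ?w (x + d) t - poly p t * ?w x t + d * (poly (pCons 0 p) t * ?w x t) \<partial>lborel)"
        unfolding lag_fun_def
          Bochner_Integration.integral_add[OF Bochner_Integration.integrable_diff[OF i1 i2] i3]
          Bochner_Integration.integral_diff[OF i1 i2] integral_mult_right_zero ..
      have "norm (lag_fun b (x + d) p - lag_fun b x p + d * lag_fun b x (pCons 0 p))
          \<le> (\<integral>t. d\<^sup>2 * \<bar>poly ?q t * ?w (x / 2) t\<bar> \<partial>lborel)"
        unfolding eq
      proof (rule Bochner_Integration.integral_norm_bound_integral)
        show "integrable lborel (\<lambda>t. poly p t * ?w (x + d) t - poly p t * ?w x t + d * (poly (pCons 0 p) t * ?w x t))"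
          by (intro Bochner_Integration.integrable_add Bochner_Integration.integrable_diff i1 i2 i3)
        show "integrable lborel (\<lambda>t. d\<^sup>2 * \<bar>poly ?q t * ?w (x / 2) t\<bar>)"
          by (intro integrable_mult_right integrable_abs integrable_poly_lag_weight xd)
        fix t :: real
        show "norm (poly p t * ?w (x + d) t - poly p t * ?w x t + d * (poly (pCons 0 p) t * ?w x t))
            \<le> d\<^sup>2 * \<bar>poly ?q t * ?w (x / 2) t\<bar>"
        proof (cases "t > 0")
          case True
          define W where "W = t powr (- b) * exp (- 1 / t)"
          have W: "W \<ge> 0" by (simp add: W_def)
          have w: "?w y t = W * exp (- (y * t))" for y
            using True by (simp add: lag_weight_def W_def exp_diff exp_minus divide_inverse)
          have "poly p t * ?w (x + d) t - poly p t * ?w x t + d * (poly (pCons 0 p) t * ?w x t)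
              = poly p t * W * exp (- (x * t)) * (exp (- (d * t)) - 1 - (- (d * t)))"
            by (simp add: w exp_add[symmetric] algebra_simps)
          also have "\<bar>\<dots>\<bar> \<le> \<bar>poly p t\<bar> * W * exp (- (x * t)) * ((d * t)\<^sup>2 * exp \<bar>d * t\<bar>)"
            using exp_second_order_bound[of "- (d * t)"] W
            by (simp add: abs_mult mult_left_mono)
          also have "\<dots> \<le> \<bar>poly p t\<bar> * W * ((d * t)\<^sup>2 * exp (- (x / 2 * t)))"
          proof -
            have "\<bar>d * t\<bar> \<le> x / 2 * t" using d True by (simp add: abs_mult)
            then have "exp (- (x * t)) * exp \<bar>d * t\<bar> \<le> exp (- (x / 2 * t))"
              by (simp add: exp_add[symmetric])
            then have "\<bar>poly p t\<bar> * W * (d * t)\<^sup>2 * (exp (- (x * t)) * exp \<bar>d * t\<bar>)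
                \<le> \<bar>poly p t\<bar> * W * (d * t)\<^sup>2 * exp (- (x / 2 * t))"
              using W by (intro mult_left_mono) auto
            then show ?thesis by (simp only: mult_ac)
          qed
          also have "\<dots> = d\<^sup>2 * \<bar>poly ?q t * ?w (x / 2) t\<bar>"
            using W by (simp add: w abs_mult power2_eq_square)
          finally show ?thesis by simp
        qed (simp add: lag_weight_def)
      qed
      then have *: "\<bar>lag_fun b (x + d) p - lag_fun b x p + d * lag_fun b x (pCons 0 p)\<bar> \<le> d\<^sup>2 * C"
        by (simp only: C_def integral_mult_right_zero real_norm_def)
      have q: "(lag_fun b (x + d) p - lag_fun b x p) / d - - lag_fun b x (pCons 0 p)
          = (lag_fun b (x + d) p - lag_fun b x p + d * lag_fun b x (pCons 0 p)) / d"
        using d by (simp add: add_divide_distrib)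
      have "d\<^sup>2 * C / \<bar>d\<bar> = \<bar>d\<bar> * C"
      proof -
        have "d\<^sup>2 = \<bar>d\<bar> * \<bar>d\<bar>" by (simp add: power2_eq_square)
        then show ?thesis using d by (simp only: mult.assoc) simp
      qed
      then show ?thesis
        unfolding q real_norm_def abs_divide using divide_right_mono[OF *, of "\<bar>d\<bar>"] by simp
    qed
    have ev: "\<forall>\<^sub>F d in at 0. d \<noteq> 0 \<and> \<bar>d\<bar> < x / 2"
      unfolding eventually_at using x by (intro exI[of _ "x / 2"]) auto
    show "\<forall>\<^sub>F d in at 0. norm ((lag_fun b (x + d) p - lag_fun b x p) / d - - lag_fun b x (pCons 0 p)) \<le> \<bar>d\<bar> * C"
      by (rule eventually_mono[OF ev bound])
    show "((\<lambda>d. \<bar>d\<bar> * C) \<longlongrightarrow> 0) (at 0)" by real_asymp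
  qed
  then show ?thesis unfolding DERIV_def by (rule LIM_zero_cancel)
qed

section \<open>Boundary terms and the Pearson equation\<close>

lemma power_lag_weight_tendsto_at_top:
  assumes "x > 0"
  shows "((\<lambda>t. t ^ k * lag_weight b x t) \<longlongrightarrow> 0) at_top"
proof -
  have "((\<lambda>t. t powr (real k - b) * exp (- 1 / t) * exp (- (x * t))) \<longlongrightarrow> 0) at_top"
    using assms by real_asymp
  then show ?thesis
    by (rule Lim_transform_eventually)
      (rule eventually_mono[OF eventually_gt_at_top[of 0]], simp add: power_mult_lag_weight)
qed

lemma power_lag_weight_tendsto_at_right_0:
  assumes "x > 0"
  shows "((\<lambda>t. t ^ k * lag_weight b x t) \<longlongrightarrow> 0) (at_right 0)"
proof -
  have "((\<lambda>t. t powr (real k - b) * exp (- 1 / t) * exp (- (x * t))) \<longlongrightarrow> 0) (at_right 0)"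
    using assms by real_asymp
  then show ?thesis
    by (rule Lim_transform_eventually)
      (rule eventually_mono[OF eventually_at_right_less[of 0]], simp add: power_mult_lag_weight)
qed

lemma poly_lag_weight_tendsto_0:
  assumes "\<And>k. ((\<lambda>t. t ^ k * lag_weight b x t) \<longlongrightarrow> 0) F"
  shows "((\<lambda>t. poly p t * lag_weight b x t) \<longlongrightarrow> 0) F"
  unfolding poly_altdef sum_distrib_right mult.assoc
  by (intro tendsto_null_sum tendsto_mult_right_zero assms)

text \<open>The fundamental theorem of calculus for t^2 q(t) w(t): exp (-1/t) kills the boundary
  term at 0 and exp (-x t) the one at infinity.\<close>

lemma lag_fun_pearson:
  assumes x: "x > 0"
  shows "lag_fun b x (pCons 0 (pCons 0 (pderiv q)) + q + smult (2 - b) (pCons 0 q)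
      - smult x (pCons 0 (pCons 0 q))) = 0" (is "lag_fun b x ?r = 0")
proof -
  let ?F = "\<lambda>t. poly (pCons 0 (pCons 0 q)) t * lag_weight b x t"
  let ?f = "\<lambda>t. poly ?r t * lag_weight b x t"
  have ein: "einterval 0 \<infinity> = {0::real<..}" by (auto simp: einterval_def)
  have "(LBINT t=0..\<infinity>. ?f t) = 0 - 0"
  proof (rule interval_integral_FTC_integrable[where F = ?F])
    fix t :: real assume t: "0 < ereal t"
    then have t0: "t > 0" by simp
    have ev: "\<forall>\<^sub>F y in nhds t. y > 0"
      using eventually_nhds_in_open[of "{0<..}" t] t0 by auto
    let ?g = "\<lambda>y. y powr (- b) * exp (- 1 / y - x * y)"
    have gt: "?g t = lag_weight b x t" using t0 by (simp add: lag_weight_def)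
    have "(?g has_real_derivative (- b * t powr (- b - 1)) * exp (- 1 / t - x * t)
        + t powr (- b) * (exp (- 1 / t - x * t) * (1 / t\<^sup>2 - x))) (at t)"
      using t0 by (auto intro!: derivative_eq_intros simp: power2_eq_square)
    also have "t powr (- b - 1) = t powr (- b) / t" using t0 by (simp add: powr_diff)
    also have "(- b * (t powr (- b) / t)) * exp (- 1 / t - x * t)
        + t powr (- b) * (exp (- 1 / t - x * t) * (1 / t\<^sup>2 - x)) = (1 / t\<^sup>2 - b / t - x) * ?g t"
      by (simp add: algebra_simps)
    finally have "(?g has_real_derivative (1 / t\<^sup>2 - b / t - x) * ?g t) (at t)" .
    from DERIV_mult[OF poly_DERIV this, of "pCons 0 (pCons 0 q)"]
    have "((\<lambda>y. poly (pCons 0 (pCons 0 q)) y * ?g y) has_real_derivative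
        poly (pderiv (pCons 0 (pCons 0 q))) t * ?g t
        + (1 / t\<^sup>2 - b / t - x) * ?g t * poly (pCons 0 (pCons 0 q)) t) (at t)" .
    also have "poly (pderiv (pCons 0 (pCons 0 q))) t * ?g t
        + (1 / t\<^sup>2 - b / t - x) * ?g t * poly (pCons 0 (pCons 0 q)) t = ?f t"
      unfolding gt using t0 by (simp add: pderiv_pCons field_simps power2_eq_square)
    finally have "((\<lambda>y. poly (pCons 0 (pCons 0 q)) y * ?g y) has_real_derivative ?f t) (at t)" .
    then have "(?F has_real_derivative ?f t) (at t)"
      by (subst DERIV_cong_ev[OF refl _ refl])
        (use ev in \<open>auto elim!: eventually_mono simp: lag_weight_def power2_eq_square\<close>)
    then show "(?F has_vector_derivative ?f t) (at t)"
      by (simp add: has_real_derivative_iff_has_vector_derivative)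
    have "isCont (\<lambda>y. poly ?r y * (y powr (- b) * exp (- 1 / y - x * y))) t"
      using t0 by (intro continuous_intros) auto
    then show "isCont ?f t"
      by (subst isCont_cong)
        (use ev in \<open>auto elim!: eventually_mono simp: lag_weight_def\<close>)
  next
    show "set_integrable lborel (einterval 0 \<infinity>) ?f"
      unfolding ein set_integrable_def
      using integrable_poly_lag_weight[OF x, of ?r b]
      by (rule Bochner_Integration.integrable_cong[THEN iffD1, rotated 2])
        (auto simp: indicator_def lag_weight_def)
    have "(?F \<longlongrightarrow> 0) (at_right 0)"
      by (intro poly_lag_weight_tendsto_0 power_lag_weight_tendsto_at_right_0 x)
    then show "((?F \<circ> real_of_ereal) \<longlongrightarrow> 0) (at_right 0)"
      using ereal_tendsto_simps1(2)[of ?F 0 0] by (simp add: zero_ereal_def)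
    have "(?F \<longlongrightarrow> 0) at_top"
      by (intro poly_lag_weight_tendsto_0 power_lag_weight_tendsto_at_top x)
    then show "((?F \<circ> real_of_ereal) \<longlongrightarrow> 0) (at_left \<infinity>)"
      by (subst ereal_tendsto_simps1)
  qed simp
  also have "(LBINT t=0..\<infinity>. ?f t) = lag_fun b x ?r"
    unfolding lag_fun_def interval_lebesgue_integral_def ein set_lebesgue_integral_def
    by (simp, intro Bochner_Integration.integral_cong refl) (auto simp: indicator_def lag_weight_def)
  finally show ?thesis by simp
qed

section \<open>Vandermonde integrals\<close>

text \<open>Induction on \<open>n\<close>: as a function of its last node the determinant is a
  polynomial with leading coefficient the smaller Vandermonde product, vanishing at the other nodes.
  If those nodes repeat, both sides are 0.\<close>

lemma det_monic_polys:
  fixes p :: "nat \<Rightarrow> real poly" and y :: "nat \<Rightarrow> real"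
  assumes deg: "\<And>j. degree (p j) = j" and monic: "\<And>j. coeff (p j) j = 1"
  shows "Determinant.det (Matrix.mat n n (\<lambda>(i, j). poly (p j) (y i))) = (\<Prod>k<n. \<Prod>j<k. y k - y j)"
proof (induction n)
  case 0
  show ?case by (simp add: Determinant.det_def)
next
  case (Suc n)
  define V where "V = (\<Prod>k<n. \<Prod>j<k. y k - y j)"
  \<comment> \<open>The last node becomes a free variable \<open>X\<close>. Cofactors along the last
    row do not see \<open>X\<close>, so they may be taken from \<open>B 0\<close>.\<close>
  define B where "B = (\<lambda>X. Matrix.mat (Suc n) (Suc n) (\<lambda>(i, j). poly (p j) (if i = n then X else y i)))"
  define C where "C = (\<lambda>j. cofactor (B 0) n j)"
  define f where "f = (\<Sum>j<Suc n. smult (C j) (p j))"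
  have B: "B X \<in> carrier_mat (Suc n) (Suc n)" for X by (simp add: B_def)
  have del: "mat_delete (B X) n j = mat_delete (B 0) n j" if "j < Suc n" for X j
    using that by (intro eq_matI) (auto simp: B_def mat_delete_def)
  have f: "Determinant.det (B X) = poly f X" for X
  proof -
    have "cofactor (B X) n j = C j" if "j < Suc n" for j
      by (simp only: C_def cofactor_def del[OF that, of X])
    moreover have "B X $$ (n, j) = poly (p j) X" if "j < Suc n" for j
      using that by (simp add: B_def)
    ultimately have "(\<Sum>j<Suc n. B X $$ (n, j) * cofactor (B X) n j) = poly f X"
      unfolding f_def poly_sum poly_smult by (intro sum.cong refl) simp
    then show ?thesis by (simp add: laplace_expansion_row[OF B, of n])
  qed
  have "mat_delete (B 0) n n = Matrix.mat n n (\<lambda>(i, j). poly (p j) (y i))"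
    by (intro eq_matI) (auto simp: B_def mat_delete_def)
  then have Cn: "C n = V" by (simp add: C_def cofactor_def Suc.IH V_def)
  have goal: "Determinant.det (B (y n)) = V * (\<Prod>j<n. y n - y j)"
  proof (cases "inj_on y {..<n}")
    case True
    define g where "g = smult V (\<Prod>j<n. [:- y j, 1:])"
    have dprod: "degree (\<Prod>j<n. [:- y j, 1:]) = n"
      by (subst degree_prod_eq_sum_degree) auto
    have "lead_coeff (\<Prod>j<n. [:- y j, 1:]) = 1"
      by (subst lead_coeff_prod) simp
    then have cprod: "coeff (\<Prod>j<n. [:- y j, 1:]) n = 1" by (simp add: dprod)
    have "coeff (f - g) i = 0" if "i \<ge> n" for i
    proof (cases "i = n")
      case True
      have "coeff (p j) n = 0" if "j < n" for j using that by (intro coeff_eq_0) (simp add: deg)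
      then show ?thesis using True
        by (simp add: f_def g_def coeff_sum cprod monic Cn)
    next
      case False
      then have "coeff (p j) i = 0" if "j < Suc n" for j
        using that \<open>i \<ge> n\<close> by (intro coeff_eq_0) (simp add: deg)
      moreover have "coeff (\<Prod>j<n. [:- y j, 1:]) i = 0"
        using False \<open>i \<ge> n\<close> by (intro coeff_eq_0) (simp add: dprod)
      ultimately show ?thesis by (simp add: f_def g_def coeff_sum)
    qed
    then have small: "f - g \<noteq> 0 \<Longrightarrow> degree (f - g) < n"
      by (meson leading_coeff_0_iff not_le)
    have roots: "y ` {..<n} \<subseteq> {z. poly (f - g) z = 0}"
    proof clarsimp
      fix i assume i: "i < n"
      have "Determinant.det (B (y i)) = 0"
        by (rule Determinant.det_identical_rows[OF B, of n i]) (use i in \<open>auto simp: B_def intro!: eq_vecI\<close>)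
      moreover have "(\<Prod>j<n. y i - y j) = 0" using i by (intro prod_zero) auto
      ultimately show "poly f (y i) = poly g (y i)"
        by (simp add: f g_def poly_prod)
    qed
    have "f - g = 0"
    proof (rule ccontr)
      assume ne: "f - g \<noteq> 0"
      have "n = card (y ` {..<n})" using True by (simp add: card_image)
      also have "\<dots> \<le> card {z. poly (f - g) z = 0}"
        by (intro card_mono roots poly_roots_finite ne)
      also have "\<dots> \<le> degree (f - g)" by (rule card_poly_roots_bound[OF ne])
      finally show False using small[OF ne] by simp
    qed
    then show ?thesis by (simp add: f g_def poly_prod)
  next
    case False
    then obtain i j where ij: "i < n" "j < i" "y i = y j"
      unfolding inj_on_def by (metis lessThan_iff linorder_neqE_nat)
    have "(\<Prod>j<i. y i - y j) = 0" using ij by (intro prod_zero) auto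
    then have "V = 0" unfolding V_def using ij by (intro prod_zero) auto
    moreover have "Determinant.det (B (y n)) = 0"
      by (rule Determinant.det_identical_rows[OF B, of i j]) (use ij in \<open>auto simp: B_def intro!: eq_vecI\<close>)
    ultimately show ?thesis by simp
  qed
  have "B (y n) = Matrix.mat (Suc n) (Suc n) (\<lambda>(i, j). poly (p j) (y i))"
    by (intro eq_matI) (auto simp: B_def)
  then show ?case using goal by (simp add: V_def)
qed

text \<open>The square is a product of two Leibniz expansions. Variables are numbered from 1 but
  matrix rows from 0, hence the index \<open>i - 1\<close>.\<close>

lemma vandermonde_square_expansion:
  fixes p :: "nat \<Rightarrow> real poly" and x :: "nat \<Rightarrow> real"
  assumes "\<And>j. degree (p j) = j" "\<And>j. coeff (p j) j = 1"
  shows "(\<Prod>(j, k)\<in>{(j, k). 1 \<le> j \<and> j < k \<and> k \<le> n}. \<bar>x k - x j\<bar> ^ 2) =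
    (\<Sum>\<sigma> | \<sigma> permutes {0..<n}. \<Sum>\<tau> | \<tau> permutes {0..<n}.
       of_int (sign \<sigma>) * of_int (sign \<tau>) *
       (\<Prod>i\<in>{1..n}. poly (p (\<sigma> (i - 1))) (x i) * poly (p (\<tau> (i - 1))) (x i)))"
proof -
  let ?y = "\<lambda>i. x (Suc i)"
  have "(\<Prod>(j, k)\<in>{(j, k). 1 \<le> j \<and> j < k \<and> k \<le> n}. \<bar>x k - x j\<bar> ^ 2)
      = (\<Prod>(k, j)\<in>(SIGMA k:{..<n}. {..<k}). (?y k - ?y j) ^ 2)"
    by (rule prod.reindex_bij_witness[of _ "\<lambda>(k, j). (Suc j, Suc k)" "\<lambda>(j, k). (k - 1, j - 1)"]) auto
  also have "\<dots> = (\<Prod>k<n. \<Prod>j<k. ?y k - ?y j) ^ 2"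
    by (simp add: prod.Sigma[symmetric] prod_power_distrib)
  also have "\<dots> = (Determinant.det (Matrix.mat n n (\<lambda>(i, j). poly (p j) (?y i))))\<^sup>2"
    by (subst det_monic_polys) (use assms in auto)
  finally have sq: "(\<Prod>(j, k)\<in>{(j, k). 1 \<le> j \<and> j < k \<and> k \<le> n}. \<bar>x k - x j\<bar> ^ 2)
      = (Determinant.det (Matrix.mat n n (\<lambda>(i, j). poly (p j) (?y i))))\<^sup>2" .
  have expand: "Determinant.det (Matrix.mat n n (\<lambda>(i, j). poly (p j) (?y i)))
      = (\<Sum>\<sigma> | \<sigma> permutes {0..<n}. of_int (sign \<sigma>) * (\<Prod>i\<in>{1..n}. poly (p (\<sigma> (i - 1))) (x i)))"
  proof -
    have "(\<Prod>i = 0..<n. Matrix.mat n n (\<lambda>(i, j). poly (p j) (?y i)) $$ (i, \<sigma> i))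
        = (\<Prod>i\<in>{1..n}. poly (p (\<sigma> (i - 1))) (x i))" if s: "\<sigma> permutes {0..<n}" for \<sigma>
    proof -
      have lt: "\<sigma> i < n" if "i < n" for i using that permutes_in_image[OF s, of i] by simp
      have "(\<Prod>i = 0..<n. Matrix.mat n n (\<lambda>(i, j). poly (p j) (?y i)) $$ (i, \<sigma> i))
          = (\<Prod>i = 0..<n. poly (p (\<sigma> i)) (?y i))"
        by (intro prod.cong refl) (simp add: lt)
      also have "\<dots> = (\<Prod>i\<in>{1..n}. poly (p (\<sigma> (i - 1))) (x i))"
        by (rule prod.reindex_bij_witness[of _ "\<lambda>i. i - 1" Suc]) auto
      finally show ?thesis .
    qed
    then show ?thesis by (simp add: Determinant.det_def)
  qed
  show ?thesis
    unfolding sq unfolding expand power2_eq_square sum_product prod.distrib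
    by (intro sum.cong refl) (simp only: mult_ac)
qed

section \<open>Andreief's identity for a one-dimensional weight\<close>

context
  fixes w :: "real \<Rightarrow> real" and p :: "nat \<Rightarrow> real poly" and n :: nat
  assumes deg: "\<And>j. degree (p j) = j" and monic: "\<And>j. coeff (p j) j = 1"
    and int: "\<And>i j. i < n \<Longrightarrow> j < n \<Longrightarrow> integrable lborel (\<lambda>t. poly (p i) t * poly (p j) t * w t)"
begin

interpretation product_sigma_finite "\<lambda>_ :: nat. lborel :: real measure" ..

lemma weighted_vandermonde_expansion:
  "(\<Prod>i\<in>{1..n}. w (x i)) * (\<Prod>(j, k)\<in>{(j, k). 1 \<le> j \<and> j < k \<and> k \<le> n}. \<bar>x k - x j\<bar> ^ 2) =
    (\<Sum>\<sigma> | \<sigma> permutes {0..<n}. \<Sum>\<tau> | \<tau> permutes {0..<n}.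
       of_int (sign \<sigma>) * of_int (sign \<tau>) *
       (\<Prod>i\<in>{1..n}. poly (p (\<sigma> (i - 1))) (x i) * poly (p (\<tau> (i - 1))) (x i) * w (x i)))"
  unfolding vandermonde_square_expansion[OF deg monic]
  by (simp add: sum_distrib_left prod.distrib mult_ac)

lemma integrable_factor:
  assumes "\<sigma> permutes {0..<n}" "\<tau> permutes {0..<n}" "i \<in> {1..n}"
  shows "integrable lborel (\<lambda>t. poly (p (\<sigma> (i - 1))) t * poly (p (\<tau> (i - 1))) t * w t)"
  using assms permutes_in_image[OF assms(1), of "i - 1"] permutes_in_image[OF assms(2), of "i - 1"]
  by (intro int) auto

lemma integrable_weighted_vandermonde:
  "integrable (PiM {1..n} (\<lambda>_. lborel)) (\<lambda>x. (\<Prod>i\<in>{1..n}. w (x i)) *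
     (\<Prod>(j, k)\<in>{(j, k). 1 \<le> j \<and> j < k \<and> k \<le> n}. \<bar>x k - x j\<bar> ^ 2))"
  unfolding weighted_vandermonde_expansion
  by (intro Bochner_Integration.integrable_sum integrable_mult_right product_integrable_prod integrable_factor) auto

text \<open>By Fubini each pair \<sigma>, \<tau> contributes a product of one-dimensional integrals.
  Orthogonality leaves the \<open>fact n\<close> diagonal pairs, each with sign 1.\<close>

lemma integral_weighted_vandermonde:
  assumes orth: "\<And>i j. i < n \<Longrightarrow> j < n \<Longrightarrow>
    (\<integral>t. poly (p i) t * poly (p j) t * w t \<partial>lborel) = (if i = j then h i else 0)"
  shows "(\<integral>x. (\<Prod>i\<in>{1..n}. w (x i)) *
     (\<Prod>(j, k)\<in>{(j, k). 1 \<le> j \<and> j < k \<and> k \<le> n}. \<bar>x k - x j\<bar> ^ 2) \<partial>(PiM {1..n} (\<lambda>_. lborel)))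
     = fact n * (\<Prod>k<n. h k)"
proof -
  let ?S = "{\<sigma>. \<sigma> permutes {0..<n}}"
  let ?F = "\<lambda>\<sigma> \<tau> x. \<Prod>i\<in>{1..n}. poly (p (\<sigma> (i - 1))) (x i) * poly (p (\<tau> (i - 1))) (x i) * w (x i)"
  have int_prod: "integrable (PiM {1..n} (\<lambda>_. lborel)) (?F \<sigma> \<tau>)"
    if "\<sigma> \<in> ?S" "\<tau> \<in> ?S" for \<sigma> \<tau>
    using that by (intro product_integrable_prod integrable_factor) auto
  have val: "(\<integral>x. ?F \<sigma> \<tau> x \<partial>(PiM {1..n} (\<lambda>_. lborel))) = (if \<tau> = \<sigma> then \<Prod>k<n. h k else 0)"
    if st: "\<sigma> \<in> ?S" "\<tau> \<in> ?S" for \<sigma> \<tau>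
  proof -
    have "(\<integral>x. ?F \<sigma> \<tau> x \<partial>(PiM {1..n} (\<lambda>_. lborel)))
        = (\<Prod>i\<in>{1..n}. \<integral>t. poly (p (\<sigma> (i - 1))) t * poly (p (\<tau> (i - 1))) t * w t \<partial>lborel)"
      using st by (intro product_integral_prod integrable_factor) auto
    also have "\<dots> = (\<Prod>i<n. \<integral>t. poly (p (\<sigma> i)) t * poly (p (\<tau> i)) t * w t \<partial>lborel)"
      by (rule prod.reindex_bij_witness[of _ Suc "\<lambda>i. i - 1"]) auto
    also have "\<dots> = (\<Prod>i<n. if \<sigma> i = \<tau> i then h (\<sigma> i) else 0)"
    proof (intro prod.cong refl orth)
      fix i assume "i \<in> {..<n}"
      then show "\<sigma> i < n" "\<tau> i < n"
        using st permutes_in_image[of \<sigma> "{0..<n}" i] permutes_in_image[of \<tau> "{0..<n}" i] by auto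
    qed
    also have "\<dots> = (if \<tau> = \<sigma> then \<Prod>k<n. h k else 0)"
    proof (cases "\<tau> = \<sigma>")
      case True
      have "(\<Prod>i<n. h (\<sigma> i)) = (\<Prod>k<n. h k)"
        using st prod.permute[of \<sigma> "{..<n}" h] by (simp add: atLeast0LessThan comp_def)
      then show ?thesis using True by simp
    next
      case False
      then obtain i where i: "\<tau> i \<noteq> \<sigma> i" by auto
      then have "i < n" using st by (metis atLeastLessThan_iff leI le0 mem_Collect_eq permutes_not_in)
      then show ?thesis using False i by auto
    qed
    finally show ?thesis .
  qed
  have fin: "finite ?S" by (rule finite_permutations) simp
  have "(\<integral>x. (\<Prod>i\<in>{1..n}. w (x i)) *
     (\<Prod>(j, k)\<in>{(j, k). 1 \<le> j \<and> j < k \<and> k \<le> n}. \<bar>x k - x j\<bar> ^ 2) \<partial>(PiM {1..n} (\<lambda>_. lborel)))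
     = (\<Sum>\<sigma>\<in>?S. \<Sum>\<tau>\<in>?S. of_int (sign \<sigma>) * of_int (sign \<tau>) * (\<integral>x. ?F \<sigma> \<tau> x \<partial>(PiM {1..n} (\<lambda>_. lborel))))"
  proof -
    have "(\<integral>x. (\<Sum>\<sigma>\<in>?S. \<Sum>\<tau>\<in>?S. of_int (sign \<sigma>) * of_int (sign \<tau>) * ?F \<sigma> \<tau> x) \<partial>(PiM {1..n} (\<lambda>_. lborel)))
        = (\<Sum>\<sigma>\<in>?S. \<integral>x. (\<Sum>\<tau>\<in>?S. of_int (sign \<sigma>) * of_int (sign \<tau>) * ?F \<sigma> \<tau> x) \<partial>(PiM {1..n} (\<lambda>_. lborel)))"
      by (intro Bochner_Integration.integral_sum Bochner_Integration.integrable_sum integrable_mult_right int_prod)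
    also have "\<dots> = (\<Sum>\<sigma>\<in>?S. \<Sum>\<tau>\<in>?S. \<integral>x. of_int (sign \<sigma>) * of_int (sign \<tau>) * ?F \<sigma> \<tau> x \<partial>(PiM {1..n} (\<lambda>_. lborel)))"
      by (intro sum.cong refl Bochner_Integration.integral_sum integrable_mult_right int_prod)
    finally show ?thesis
      unfolding weighted_vandermonde_expansion integral_mult_right_zero .
  qed
  also have "\<dots> = (\<Sum>\<sigma>\<in>?S. \<Sum>\<tau>\<in>?S. if \<tau> = \<sigma> then \<Prod>k<n. h k else 0)"
  proof (intro sum.cong refl)
    fix \<sigma> \<tau> assume st: "\<sigma> \<in> ?S" "\<tau> \<in> ?S"
    have "of_int (sign \<sigma>) * of_int (sign \<sigma>) = (1 :: real)"
      by (simp flip: of_int_mult)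
    then show "of_int (sign \<sigma>) * of_int (sign \<tau>) * (\<integral>x. ?F \<sigma> \<tau> x \<partial>(PiM {1..n} (\<lambda>_. lborel)))
        = (if \<tau> = \<sigma> then \<Prod>k<n. h k else 0)"
      unfolding val[OF st] by simp
  qed
  also have "\<dots> = (\<Sum>\<sigma>\<in>?S. \<Prod>k<n. h k)"
    using fin by (intro sum.cong refl) (simp add: sum.delta)
  also have "\<dots> = fact n * (\<Prod>k<n. h k)"
    using card_permutations[of "{0..<n}" n] by simp
  finally show ?thesis .
qed

end

section \<open>The differential equation\<close>

lemma laguerre_type_family_lag_fun: "laguerre_type_family (lag_fun b) b"
proof (intro laguerre_type_family.intro laplace_family.intro laguerre_type_family_axioms.intro)
  show "positive_functional (lag_fun b x)" if "x > 0" for x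
    by (rule positive_functional_lag_fun[OF that])
  show "((\<lambda>y. lag_fun b y p) has_real_derivative - lag_fun b x (pCons 0 p)) (at x)" if "x > 0" for x p
    by (rule lag_fun_deriv[OF that])
  show "laguerre_type_functional (lag_fun b x) b x" if "x > 0" for x
    by (intro laguerre_type_functional.intro laguerre_type_functional_axioms.intro
        positive_functional_lag_fun lag_fun_pearson that)
qed

section \<open>The n-fold integral and its logarithmic derivative\<close>

lemma I2_eq_integral:
  "I2 n (- x) = (\<integral>y. (\<Prod>i\<in>{1..n}. lag_weight (b_exp 2 n) x (y i)) *
     (\<Prod>(j, k)\<in>{(j, k). 1 \<le> j \<and> j < k \<and> k \<le> n}. \<bar>y k - y j\<bar> ^ 2) \<partial>(PiM {1..n} (\<lambda>_. lborel)))"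
  unfolding I2_def set_lebesgue_integral_def
proof (intro Bochner_Integration.integral_cong refl)
  fix y :: "nat \<Rightarrow> real"
  assume y: "y \<in> space (PiM {1..n} (\<lambda>_. lborel))"
  let ?V = "\<Prod>(j, k)\<in>{(j, k). 1 \<le> j \<and> j < k \<and> k \<le> n}. \<bar>y k - y j\<bar> ^ 2"
  show "indicat_real (Rplus n) y *\<^sub>R weight2 n (- x) y
      = (\<Prod>i\<in>{1..n}. lag_weight (b_exp 2 n) x (y i)) * ?V"
  proof (cases "\<forall>i\<in>{1..n}. y i > 0")
    case True
    then have "y \<in> Rplus n"
      using y by (auto simp: Rplus_def space_PiM PiE_def)
    then show ?thesis using True by (simp add: weight2_def lag_weight_def)
  next
    case False
    then have "y \<notin> Rplus n" by (auto simp: Rplus_def)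
    moreover have "(\<Prod>i\<in>{1..n}. lag_weight (b_exp 2 n) x (y i)) = 0"
      using False by (intro prod_zero) (auto simp: lag_weight_def)
    ultimately show ?thesis by simp
  qed
qed

lemma I2_eq_prod_norms:
  assumes "x > 0"
  shows "I2 n (- x) = fact n * (\<Prod>k<n. orth_norm (lag_fun (b_exp 2 n) x) k)"
proof -
  let ?L = "lag_fun (b_exp 2 n) x"
  interpret positive_functional ?L by (rule positive_functional_lag_fun[OF assms])
  have eq: "poly (P i) t * poly (P j) t * lag_weight (b_exp 2 n) x t
      = poly (P i * P j) t * lag_weight (b_exp 2 n) x t" for i j t by simp
  show ?thesis
    unfolding I2_eq_integral
  proof (rule integral_weighted_vandermonde[where p = P])
    show "integrable lborel (\<lambda>t. poly (P i) t * poly (P j) t * lag_weight (b_exp 2 n) x t)" for i j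
      unfolding eq by (rule integrable_poly_lag_weight[OF assms])
    show "(\<integral>t. poly (P i) t * poly (P j) t * lag_weight (b_exp 2 n) x t \<partial>lborel) = (if i = j then h i else 0)" for i j
      unfolding eq lag_fun_def[symmetric] using orthogonal[of j i] by (simp add: L_P_P)
  qed auto
qed

lemma I2_pos:
  assumes "x > 0"
  shows "I2 n (- x) > 0"
proof -
  interpret positive_functional "lag_fun (b_exp 2 n) x" by (rule positive_functional_lag_fun[OF assms])
  show ?thesis unfolding I2_eq_prod_norms[OF assms] by (simp add: h_pos prod_pos)
qed

text \<open>A divergent Bochner integral has value 0, so integrability at parameter 0 must come
  first; then monotonicity in the parameter compares \<open>m2 n\<close> with the positive number
  \<open>I2 n (- 1)\<close>.\<close>

lemma m2_pos:
  assumes "n \<ge> 1"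
  shows "m2 n > 0"
proof -
  let ?b = "b_exp 2 n"
  let ?V = "\<lambda>y :: nat \<Rightarrow> real. \<Prod>(j, k)\<in>{(j, k). 1 \<le> j \<and> j < k \<and> k \<le> n}. \<bar>y k - y j\<bar> ^ 2"
  have V: "?V y \<ge> 0" for y by (intro prod_nonneg) auto
  have int: "integrable lborel (\<lambda>t. poly (monom 1 i) t * poly (monom 1 j) t * lag_weight ?b x t)"
    if x: "x \<ge> 0" and ij: "i < n" "j < n" for x :: real and i j
  proof -
    have "integrable lborel (\<lambda>t. t ^ (i + j) * lag_weight ?b x t)"
    proof (cases "x = 0")
      case True
      \<comment> \<open>Exponents reach at most 2n - 2 while \<open>b_exp 2 n\<close> is 3n, which
        leaves the decay needed at infinity.\<close>
      have "i + j + 2 \<le> 2 * n" using ij by linarith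
      then have "real (i + j) + 2 \<le> 2 * real n"
        by (metis of_nat_add of_nat_le_iff of_nat_mult of_nat_numeral)
      then have "real (i + j) - ?b \<le> - 2" using assms by (simp add: b_exp_def)
      then show ?thesis unfolding True by (rule integrable_power_lag_weight_0)
    qed (use x in \<open>auto intro!: integrable_power_lag_weight\<close>)
    then show ?thesis by (simp add: poly_monom power_add)
  qed
  have intV: "integrable (PiM {1..n} (\<lambda>_. lborel)) (\<lambda>y. (\<Prod>i\<in>{1..n}. lag_weight ?b x (y i)) * ?V y)"
    if "x \<ge> 0" for x
    by (rule integrable_weighted_vandermonde[where p = "monom 1"]) (auto simp: degree_monom_eq int that)
  have "0 < I2 n (- 1)" by (rule I2_pos) simp
  also have "I2 n (- 1) \<le> I2 n (- 0)"
    unfolding I2_eq_integral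
  proof (rule integral_mono[OF intV intV])
    fix y :: "nat \<Rightarrow> real"
    show "(\<Prod>i\<in>{1..n}. lag_weight ?b 1 (y i)) * ?V y \<le> (\<Prod>i\<in>{1..n}. lag_weight ?b 0 (y i)) * ?V y"
      by (intro mult_right_mono prod_mono conjI lag_weight_nonneg V) (auto simp: lag_weight_def)
  qed auto
  finally show ?thesis by (simp add: m2_def)
qed

text \<open>The logarithm turns the product of norms into a sum, and \<open>h_deriv\<close> with the
  inner sign of \<open>- y\<close> contributes one \<open>a\<close> per factor.\<close>

lemma xi2_deriv:
  assumes n: "n \<ge> 1" and z: "z < 0"
  shows "(xi2 n has_real_derivative - rec_s (lag_fun (b_exp 2 n) (- z)) n) (at z)"
proof -
  interpret laguerre_type_family "lag_fun (b_exp 2 n)" "b_exp 2 n" by (rule laguerre_type_family_lag_fun)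
  have hpos: "hf k x > 0" if "x > 0" for k x
    using positive_functional.h_pos[OF pos[OF that]] .
  let ?c = "ln (fact n / m2 n)"
  have eq: "xi2 n y = ?c + (\<Sum>k<n. ln (hf k (- y)))" if "y < 0" for y
  proof -
    have "M2 n y = fact n / m2 n * (\<Prod>k<n. hf k (- y))"
      using I2_eq_prod_norms[of "- y" n] that by (simp add: M2_def)
    moreover have "fact n / m2 n > 0" using m2_pos[OF n] by simp
    moreover have "(\<Prod>k<n. hf k (- y)) > 0" using that by (intro prod_pos) (simp add: hpos)
    moreover have "ln (\<Prod>k<n. hf k (- y)) = (\<Sum>k<n. ln (hf k (- y)))"
    proof (intro ln_prod)
      show "hf k (- y) \<noteq> 0" for k using hpos[of "- y" k] that by simp
    qed simp
    ultimately show ?thesis by (simp only: xi2_def ln_mult_pos)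
  qed
  have "((\<lambda>y. ?c + (\<Sum>k<n. ln (hf k (- y)))) has_real_derivative 0 + (\<Sum>k<n. af k (- z))) (at z)"
  proof (intro DERIV_add DERIV_const DERIV_sum)
    fix k
    have x: "- z > 0" using z by simp
    have h': "((\<lambda>y. hf k (- y)) has_real_derivative (- af k (- z) * hf k (- z)) * - 1) (at z)"
      by (rule DERIV_chain2[where f = "hf k" and g = uminus, OF h_deriv[OF x]]) (auto intro!: derivative_eq_intros)
    have "inverse (hf k (- z)) * ((- af k (- z) * hf k (- z)) * - 1) = af k (- z)"
      using hpos[OF x, of k] by (simp add: field_simps)
    then show "((\<lambda>y. ln (hf k (- y))) has_real_derivative af k (- z)) (at z)"
      using DERIV_chain2[OF DERIV_ln[OF hpos[OF x]] h'] by (simp only:)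
  qed
  then have "(xi2 n has_real_derivative 0 + (\<Sum>k<n. af k (- z))) (at z)"
    by (rule has_field_derivative_transform_within_open[where S = "{..<0}"]) (simp_all add: z eq)
  then show ?thesis by (simp add: rec_s_def)
qed

theorem corollary2p10:
  fixes n :: nat and b :: real and H :: "real \<Rightarrow> real"
  assumes "n \<ge> 1"
    and "b = b_exp 2 n"
    and "\<forall>z<0. H (- z) = z * deriv (xi2 n) z"
  shows "(\<forall>z<0. xi2 n differentiable (at z)) \<and>
    (\<forall>z>0. H differentiable (at z) \<and> deriv H differentiable (at z) \<and>
      (z * deriv (deriv H) z)\<^sup>2 =
        4 * H z * ((deriv H z)\<^sup>2 - deriv H z)
        - (4 * z * (deriv H z)\<^sup>2 - (4 * z + (b - 2 * real n)\<^sup>2) * deriv H z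
           - 2 * real n * (b - 2 * real n)) * deriv H z
        + (real n)\<^sup>2)"
proof (intro conjI allI impI)
  fix z :: real assume "z < 0"
  then show "xi2 n differentiable (at z)"
    using xi2_deriv[OF assms(1)] by (auto simp: real_differentiable_def)
next
  fix z :: real assume z: "z > 0"
  interpret laguerre_type_family "lag_fun b" b by (rule laguerre_type_family_lag_fun)
  \<comment> \<open>The hypothesis is read at \<open>- y\<close>; its sign cancels the one in
    \<open>xi2_deriv\<close>.\<close>
  have H: "H y = y * sf n y" if "y > 0" for y
    using assms(3)[rule_format, of "- y"] DERIV_imp_deriv[OF xi2_deriv[OF assms(1), of "- y"]] that assms(2)
    by simp
  \<comment> \<open>\<open>H\<close> is known only on the positive half-line, so derivatives are
    transferred on this open set, here and for \<open>deriv H\<close> below.\<close>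
  have H': "(H has_real_derivative sf n y + y * \<beta>f n y) (at y)" if y: "y > 0" for y
  proof (rule has_field_derivative_transform_within_open[where S = "{0<..}"])
    show "((\<lambda>y. y * sf n y) has_real_derivative sf n y + y * \<beta>f n y) (at y)"
      by (rule sigma_form[OF y assms(1)])
  qed (use y in \<open>auto simp: H\<close>)
  obtain S'' where S'': "((\<lambda>y. sf n y + y * \<beta>f n y) has_real_derivative S'') (at z)"
    and ode: "(z * S'')\<^sup>2 = 4 * (z * sf n z) * ((sf n z + z * \<beta>f n z)\<^sup>2 - (sf n z + z * \<beta>f n z))
        - (4 * z * (sf n z + z * \<beta>f n z)\<^sup>2 - (4 * z + (b - 2 * real n)\<^sup>2) * (sf n z + z * \<beta>f n z)
           - 2 * real n * (b - 2 * real n)) * (sf n z + z * \<beta>f n z) + (real n)\<^sup>2"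
    using sigma_form[OF z assms(1)] by blast
  have dH: "deriv H y = sf n y + y * \<beta>f n y" if "y > 0" for y
    by (rule DERIV_imp_deriv[OF H'[OF that]])
  have H'': "(deriv H has_real_derivative S'') (at z)"
    using S'' by (rule has_field_derivative_transform_within_open[where S = "{0<..}"]) (use z in \<open>auto simp: dH\<close>)
  show "H differentiable (at z)" using H'[OF z] by (auto simp: real_differentiable_def)
  show "deriv H differentiable (at z)" using H'' by (auto simp: real_differentiable_def)
  show "(z * deriv (deriv H) z)\<^sup>2 =
        4 * H z * ((deriv H z)\<^sup>2 - deriv H z)
        - (4 * z * (deriv H z)\<^sup>2 - (4 * z + (b - 2 * real n)\<^sup>2) * deriv H z
           - 2 * real n * (b - 2 * real n)) * deriv H z
        + (real n)\<^sup>2"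
    unfolding DERIV_imp_deriv[OF H''] dH[OF z] H[OF z] by (rule ode)
qed

end
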